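(* Let $g:\mathbb{D}\to\mathbb{D}$ be a hyperbolic holomorphic self-map with Denjoy--Wolff point $\tau\in\partial\mathbb{D}$ and angular multiplier $\alpha=g'(\tau)\in(0,1)$. Then there exist a real constant $b\in\mathbb{R}$ and a finite positive Borel measure $\sigma$ on $\partial\mathbb{D}\setminus\{\tau\}$ (so $\sigma(\partial\mathbb{D}\setminus\{\tau\})<\infty$) such that $$\frac{1+\overline{\tau}g(z)}{1-\overline{\tau}g(z)}=\frac{1}{\alpha}\,\frac{1+\overline{\tau}z}{1-\overline{\tau}z}+ib+\int_{\partial\mathbb{D}\setminus\{\tau\}}\frac{\zeta+z}{\zeta-z}\,d\sigma(\zeta),\qquad z\in\mathbb{D}.$$ Moreover, $g$ has an extremal hyperbolic rate if and only if $$\int_{\partial\mathbb{D}\setminus\{\tau\}}\log\frac{1}{|\zeta-\tau|}\,d\sigma(\zeta)<\infty.$$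
   Context: $\mathbb{D}=\{z\in\mathbb{C}:|z|<1\}$. $g^{\circ n}$ denotes the $n$-th iterate of $g$. The hyperbolic distance on $\mathbb{D}$ (curvature $-1$, density $2/(1-|z|^2)$) is $\rho_{\mathbb{D}}(z,w)=2\tanh^{-1}\left|\frac{z-w}{1-\bar w z}\right|$. A holomorphic $g:\mathbb{D}\to\mathbb{D}$ with no fixed point in $\mathbb{D}$ has a unique Denjoy--Wolff point $\tau\in\partial\mathbb{D}$, with $g^{\circ n}(z)\to\tau$ for every $z\in\mathbb{D}$. The angular (non-tangential) limit $g'(\tau):=\angle\lim_{z\to\tau}g'(z)=:\alpha$ exists, equals $\liminf_{z\to\tau}\frac{1-|g(z)|}{1-|z|}$, and lies in $(0,1]$; it is called the (angular) multiplier or angular derivative of $g$ at $\tau$. The map $g$ is called hyperbolic if $\alpha\in(0,1)$. A hyperbolic $g$ has an extremal hyperbolic rate if for some (equivalently, every) $z,w\in\mathbb{D}$ the quantity $\rho_{\mathbb{D}}(g^{\circ n}(z),w)-n\log\frac1\alpha$ is bounded as $n\to\infty$ (the bound may depend on $z,w,g$). *)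

theory Defs
  imports "HOL-Complex_Analysis.Complex_Analysis"
begin

abbreviation unit_disc :: "complex set" where
  "unit_disc \<equiv> ball 0 1"

abbreviation unit_circle :: "complex set" where
  "unit_circle \<equiv> sphere 0 1"

definition hyp_dist :: "complex \<Rightarrow> complex \<Rightarrow> real" where
  "hyp_dist z w = 2 * artanh (cmod ((z - w) / (1 - cnj w * z)))"

definition stolz_region :: "complex \<Rightarrow> real \<Rightarrow> complex set" where
  "stolz_region \<tau> M = {z \<in> unit_disc. cmod (z - \<tau>) < M * (1 - cmod z)}"

text \<open>
  The filter of non-tangential approach to a boundary point. In the lattice of filters, a limit
  along a supremum is a limit along each member, so \<open>(f \<longlongrightarrow> l) (angular_at \<tau>)\<close> says that \<open>f\<close> tends
  to \<open>l\<close> within every Stolz region with vertex \<open>\<tau>\<close>.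
\<close>
definition angular_at :: "complex \<Rightarrow> complex filter" where
  "angular_at \<tau> = (SUP M\<in>{1<..}. at \<tau> within stolz_region \<tau> M)"

lemma tendsto_angular_at_iff:
  "(f \<longlongrightarrow> l) (angular_at \<tau>) \<longleftrightarrow> (\<forall>M>1. (f \<longlongrightarrow> l) (at \<tau> within stolz_region \<tau> M))"
  unfolding angular_at_def filterlim_def filtermap_SUP by (auto simp: SUP_le_iff)

definition denjoy_wolff_point :: "(complex \<Rightarrow> complex) \<Rightarrow> complex \<Rightarrow> bool" where
  "denjoy_wolff_point g \<tau> \<longleftrightarrow>
     \<tau> \<in> unit_circle \<and> (\<forall>z\<in>unit_disc. (\<lambda>n. (g ^^ n) z) \<longlonglongrightarrow> \<tau>)"

definition hyperbolic_self_map :: "(complex \<Rightarrow> complex) \<Rightarrow> complex \<Rightarrow> real \<Rightarrow> bool" where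
  "hyperbolic_self_map g \<tau> \<alpha> \<longleftrightarrow>
     g holomorphic_on unit_disc \<and> g ` unit_disc \<subseteq> unit_disc \<and>
     (\<forall>z\<in>unit_disc. g z \<noteq> z) \<and>
     denjoy_wolff_point g \<tau> \<and>
     (deriv g \<longlongrightarrow> complex_of_real \<alpha>) (angular_at \<tau>) \<and>
     0 < \<alpha> \<and> \<alpha> < 1"

text \<open>Here \<open>\<alpha>\<close> is meant to be the angular multiplier of the hyperbolic map \<open>g\<close>.\<close>
definition extremal_hyperbolic_rate :: "(complex \<Rightarrow> complex) \<Rightarrow> real \<Rightarrow> bool" where
  "extremal_hyperbolic_rate g \<alpha> \<longleftrightarrow>
     (\<exists>z\<in>unit_disc. \<exists>w\<in>unit_disc.
        bounded (range (\<lambda>n. hyp_dist ((g ^^ n) z) w - real n * ln (1 / \<alpha>))))"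

definition finite_borel_measure_on :: "complex set \<Rightarrow> complex measure \<Rightarrow> bool" where
  "finite_borel_measure_on S \<sigma> \<longleftrightarrow>
     sets \<sigma> = sets (restrict_space borel S) \<and> finite_measure \<sigma>"

definition herglotz_rep ::
  "(complex \<Rightarrow> complex) \<Rightarrow> complex \<Rightarrow> real \<Rightarrow> real \<Rightarrow> complex measure \<Rightarrow> bool" where
  "herglotz_rep g \<tau> \<alpha> b \<sigma> \<longleftrightarrow>
     (\<forall>z\<in>unit_disc.
        (1 + cnj \<tau> * g z) / (1 - cnj \<tau> * g z) =
          1 / complex_of_real \<alpha> * ((1 + cnj \<tau> * z) / (1 - cnj \<tau> * z))
          + \<i> * complex_of_real b
          + (\<integral>\<zeta>. (\<zeta> + z) / (\<zeta> - z) \<partial>\<sigma>))"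

end

theory Submission
  imports Defs "HOL-Probability.Probability"
begin

text \<open>
  Write \<open>K \<zeta> z = (\<zeta> + z) / (\<zeta> - z)\<close>. For \<open>\<zeta>\<close> on the unit circle, \<open>K \<zeta>\<close> maps the disc onto the right
  half-plane, its real part is the Poisson kernel \<open>(1 - |z|\<^sup>2) / |\<zeta> - z|\<^sup>2\<close>, and
  \<open>(1 + cnj \<tau> z) / (1 - cnj \<tau> z) = K \<tau> z\<close>.

  \<^bold>\<open>Existence of the representation.\<close> The function \<open>p z = K \<tau> (g z)\<close> has positive real part, so Herglotz's
  theorem (\<open>herglotz_representation\<close>) writes it as an imaginary constant plus the integral of \<open>K \<zeta> z\<close>
  against a finite measure \<open>\<mu>\<close> on the whole circle. What has to be seen is that \<open>\<mu>\<close> has mass exactly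
  \<open>1/\<alpha>\<close> at \<open>\<tau>\<close>; removing this atom leaves \<open>\<sigma>\<close>. By dominated convergence \<open>(1 - r) p(r \<tau>)\<close> tends to
  \<open>2 \<mu>{\<tau>}\<close> as \<open>r \<rightarrow> 1\<close> (\<open>herglotz_point_mass\<close>). On the other hand \<open>wolff_lemma\<close>, the invariance of horodiscs
  at the Denjoy--Wolff point, forces \<open>g(r \<tau>) \<rightarrow> \<tau>\<close>, and then the limit of \<open>g'\<close> along the radius is the
  limit of the difference quotient (\<open>radial_difference_quotient\<close>), so that \<open>(1 - r) p(r \<tau>) \<rightarrow> 2/\<alpha>\<close>.

  \<^bold>\<open>The rate.\<close> Follow an orbit \<open>z\<^sub>n\<close> and put \<open>w\<^sub>n = K \<tau> z\<^sub>n\<close>, \<open>u\<^sub>n = Re w\<^sub>n\<close> and \<open>q\<^sub>n = |\<tau> - z\<^sub>n|\<close>. The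
  real part of the representation says \<open>u\<^sub>n\<^sub>+\<^sub>1 = u\<^sub>n (1/\<alpha> + I\<^sub>n)\<close>, where \<open>I\<^sub>n \<ge> 0\<close> is the integral of
  \<open>q\<^sub>n\<^sup>2 / |\<zeta> - z\<^sub>n|\<^sup>2\<close> against \<open>\<sigma>\<close>. By Schwarz--Pick the hyperbolic step of the orbit does not increase, so
  \<open>|w\<^sub>n\<^sub>+\<^sub>1 - w\<^sub>n| \<le> D u\<^sub>n\<close>; since \<open>u\<^sub>n\<close> grows at least geometrically, these steps add up to
  \<open>|w\<^sub>n| \<le> M u\<^sub>n\<close> (\<open>sector\<close>): the orbit is non-tangential. Three consequences follow.

  First, the hyperbolic distance of \<open>z\<^sub>n\<close> from a base point is \<open>ln u\<^sub>n\<close> up to a bounded error, so the rate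
  is extremal iff \<open>\<alpha>\<^sup>n u\<^sub>n = u\<^sub>0 \<Prod>k<n. (1 + \<alpha> I\<^sub>k)\<close> is bounded, that is, iff \<open>\<Sum> I\<^sub>n\<close> converges.
  Second, \<open>|\<zeta> - z\<^sub>n|\<close> is comparable with \<open>|\<zeta> - \<tau>| + q\<^sub>n\<close>.
  Third, \<open>q\<^sub>n\<close> is comparable with \<open>1/u\<^sub>n\<close> and hence lies between two decreasing geometric sequences.
  So the sum over \<open>n\<close> of \<open>q\<^sub>n\<^sup>2 / (|\<zeta> - \<tau>| + q\<^sub>n)\<^sup>2\<close> essentially counts the \<open>n\<close> with \<open>q\<^sub>n \<ge> |\<zeta> - \<tau>|\<close>, and
  this number lies between two increasing affine functions of \<open>ln (1 / |\<zeta> - \<tau>|)\<close> once \<open>\<zeta>\<close> is close to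
  \<open>\<tau>\<close>. Integrating against \<open>\<sigma>\<close> turns the convergence of \<open>\<Sum> I\<^sub>n\<close> into the integrability of the logarithm
  (\<open>sum_integrals_bounded_iff_log_integrable\<close>).
\<close>

section \<open>The Herglotz kernel\<close>

definition herglotz_kernel :: "complex \<Rightarrow> complex \<Rightarrow> complex" where
  "herglotz_kernel \<zeta> z = (\<zeta> + z) / (\<zeta> - z)"

lemma Re_herglotz_kernel:
  assumes "cmod \<zeta> = 1"
  shows "Re (herglotz_kernel \<zeta> z) = (1 - (cmod z)\<^sup>2) / (cmod (\<zeta> - z))\<^sup>2"
proof -
  have "Re (herglotz_kernel \<zeta> z) = Re ((\<zeta> + z) * cnj (\<zeta> - z)) / (cmod (\<zeta> - z))\<^sup>2"
    unfolding herglotz_kernel_def by (subst complex_div_cnj) (metis Re_divide_of_real of_real_power)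
  also have "Re ((\<zeta> + z) * cnj (\<zeta> - z)) = (cmod \<zeta>)\<^sup>2 - (cmod z)\<^sup>2"
    unfolding cmod_power2 by (simp add: algebra_simps power2_eq_square)
  finally show ?thesis
    using assms by simp
qed

lemma Re_herglotz_kernel_pos:
  assumes "cmod \<zeta> = 1" "z \<in> unit_disc"
  shows "0 < Re (herglotz_kernel \<zeta> z)"
  unfolding Re_herglotz_kernel[OF assms(1)]
  using assms by (intro divide_pos_pos) (auto simp: power_less_one_iff)

lemma herglotz_kernel_cayley:
  assumes "cmod \<tau> = 1"
  shows "(1 + cnj \<tau> * z) / (1 - cnj \<tau> * z) = herglotz_kernel \<tau> z"
proof -
  have "cnj \<tau> * \<tau> = 1"
    using assms complex_norm_square[of \<tau>] by (simp add: mult.commute)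
  then have "\<tau> + z = \<tau> * (1 + cnj \<tau> * z)" "\<tau> - z = \<tau> * (1 - cnj \<tau> * z)" "\<tau> \<noteq> 0"
    by (auto simp: algebra_simps)
  then show ?thesis by (simp add: herglotz_kernel_def)
qed

lemma herglotz_kernel_plus_one:
  assumes "\<zeta> \<noteq> z"
  shows "herglotz_kernel \<zeta> z + 1 = 2 * \<zeta> / (\<zeta> - z)"
  using assms by (simp add: herglotz_kernel_def field_simps)

lemma herglotz_kernel_bound:
  assumes "cmod \<zeta> = 1" "cmod z < 1"
  shows "cmod (herglotz_kernel \<zeta> z) \<le> 2 / (1 - cmod z)"
proof -
  have "cmod (\<zeta> + z) \<le> 2" using norm_triangle_ineq[of \<zeta> z] assms by simp
  moreover have "1 - cmod z \<le> cmod (\<zeta> - z)" using norm_triangle_ineq2[of \<zeta> z] assms by simp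
  ultimately show ?thesis
    unfolding herglotz_kernel_def norm_divide using assms by (intro frac_le) auto
qed

lemma integrable_herglotz_kernel:
  assumes \<mu>: "finite_measure \<mu>" "sets \<mu> = sets (restrict_space borel S)" and S: "S \<subseteq> unit_circle"
    and z: "z \<in> unit_disc"
  shows "integrable \<mu> (\<lambda>\<zeta>. herglotz_kernel \<zeta> z)"
proof -
  have sp: "space \<mu> = S" using sets_eq_imp_space_eq[OF \<mu>(2)] by (simp add: space_restrict_space)
  have "(\<lambda>\<zeta>. herglotz_kernel \<zeta> z) \<in> borel_measurable (restrict_space borel S)"
    unfolding herglotz_kernel_def by (intro borel_measurable_continuous_on_restrict continuous_intros)
      (use S z in auto)
  then have [measurable]: "(\<lambda>\<zeta>. herglotz_kernel \<zeta> z) \<in> borel_measurable \<mu>"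
    using measurable_cong_sets[OF \<mu>(2) refl] by blast
  show ?thesis
    by (rule finite_measure.integrable_const_bound[OF \<mu>(1), of _ "2 / (1 - cmod z)"])
       (use S z sp in \<open>auto intro!: AE_I2 herglotz_kernel_bound\<close>)
qed

section \<open>Herglotz's representation theorem\<close>

text \<open>
  Add Cauchy's formula for \<open>q\<close> to its conjugate counterpart, which yields \<open>cnj (q 0)\<close>, to get the
  integral of \<open>2 Re q\<close> against the Cauchy kernel \<open>\<zeta> / (\<zeta> - z)\<close>. As \<open>herglotz_kernel \<zeta> z\<close> is twice
  this kernel minus \<open>1\<close>, subtracting the mean value \<open>Re (q 0)\<close> gives the formula.
\<close>

lemma schwarz_integral_formula:
  assumes q: "q holomorphic_on cball 0 1" and z: "cmod z < 1"
  shows "((\<lambda>t. Re (q (cis (2 * pi * t))) *\<^sub>R herglotz_kernel (cis (2 * pi * t)) z)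
           has_integral (q z - \<i> * Im (q 0))) {0..1}"
proof -
  have cauchy: "((\<lambda>t. h (cis (2 * pi * t)) * (cis (2 * pi * t) / (cis (2 * pi * t) - w)))
                  has_integral h w) {0..1}"
    if "h holomorphic_on cball 0 1" "cmod w < 1" for h w
  proof -
    have "((\<lambda>u. h u / (u - w)) has_contour_integral (2 * of_real pi * \<i> * h w)) (circlepath 0 1)"
      by (rule Cauchy_integral_circlepath_simple) (use that in auto)
    then have "((\<lambda>t. h (cis (2 * pi * t)) / (cis (2 * pi * t) - w) *
                  (2 * of_real pi * \<i> * cis (2 * pi * t))) has_integral (2 * of_real pi * \<i> * h w)) {0..1}"
      unfolding has_contour_integral_def
      by (rule has_integral_eq[rotated])
         (simp add: vector_derivative_circlepath01, simp add: circlepath cis_conv_exp mult_ac)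
    from has_integral_mult_right[OF this, of "1 / (2 * of_real pi * \<i>)"]
    show ?thesis
      by (rule has_integral_eq_rhs[OF has_integral_eq[rotated]]) (auto simp: field_simps)
  qed
  have e_ne: "cis (2 * pi * t) \<noteq> z" for t
    using z by auto
  (* Reflecting z to 1 / cnj z, outside the disc, turns the Cauchy kernel at z into a function that
     only sees the value of q at 0; its conjugate is the Cauchy integral of cnj q. *)
  have "((\<lambda>t. q (cis (2 * pi * t)) / (1 - cnj z * cis (2 * pi * t))) has_integral q 0) {0..1}"
  proof -
    have "1 - cnj z * u \<noteq> 0" if "cmod u \<le> 1" for u
    proof
      assume "1 - cnj z * u = 0"
      then have "cmod (cnj z * u) = 1"
        by simp
      then have "cmod z * cmod u = 1"
        by (simp add: norm_mult)
      moreover have "cmod z * cmod u \<le> cmod z"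
        using mult_left_le[OF that, of "cmod z"] by simp
      ultimately show False using z by simp
    qed
    then have "(\<lambda>u. q u / (1 - cnj z * u)) holomorphic_on cball 0 1"
      by (intro holomorphic_intros q) auto
    from cauchy[OF this, of 0] show ?thesis by simp
  qed
  then have "((\<lambda>t. cnj (q (cis (2 * pi * t)) / (1 - cnj z * cis (2 * pi * t)))) has_integral cnj (q 0)) {0..1}"
    by (rule has_integral_cnj[THEN iffD2, unfolded o_def])
  then have B: "((\<lambda>t. cnj (q (cis (2 * pi * t))) * (cis (2 * pi * t) / (cis (2 * pi * t) - z)))
      has_integral cnj (q 0)) {0..1}"
  proof (rule has_integral_eq[rotated])
    fix t :: real
    have "cis (2 * pi * t) * (1 - z * cnj (cis (2 * pi * t))) = cis (2 * pi * t) - z"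
      by (simp add: algebra_simps cis_cnj cis_mult)
    moreover have "1 - z * cnj (cis (2 * pi * t)) \<noteq> 0"
      using e_ne[of t] calculation by (metis eq_iff_diff_eq_0 mult_zero_right)
    ultimately have "1 / (1 - z * cnj (cis (2 * pi * t))) = cis (2 * pi * t) / (cis (2 * pi * t) - z)"
      using e_ne[of t] by (simp add: field_simps)
    then show "cnj (q (cis (2 * pi * t)) / (1 - cnj z * cis (2 * pi * t))) =
        cnj (q (cis (2 * pi * t))) * (cis (2 * pi * t) / (cis (2 * pi * t) - z))"
      by (simp add: divide_inverse)
  qed
  have "((\<lambda>t. q (cis (2 * pi * t))) has_integral q 0) {0..1}"
    using cauchy[OF q, of 0] by simp
  then have "((\<lambda>t. complex_of_real (Re (q (cis (2 * pi * t))))) has_integral of_real (Re (q 0))) {0..1}"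
    by (intro has_integral_of_real has_integral_Re)
  from has_integral_diff[OF has_integral_add[OF cauchy[OF q z] B] this]
  show ?thesis
  proof (rule has_integral_eq_rhs[OF has_integral_eq[rotated]])
    fix t :: real
    let ?e = "cis (2 * pi * t)"
    define X where "X = ?e / (?e - z)"
    have K: "herglotz_kernel ?e z = 2 * X - 1"
      using e_ne[of t] by (simp add: herglotz_kernel_def X_def field_simps)
    have S: "q ?e + cnj (q ?e) = 2 * Re (q ?e)"
      by (simp add: complex_add_cnj)
    have "Re (q ?e) *\<^sub>R herglotz_kernel ?e z = (q ?e + cnj (q ?e)) * X - Re (q ?e)"
      unfolding K S scaleR_conv_of_real by (simp add: algebra_simps)
    then show "q ?e * (?e / (?e - z)) + cnj (q ?e) * (?e / (?e - z)) - Re (q ?e)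
        = Re (q ?e) *\<^sub>R herglotz_kernel ?e z"
      by (simp add: X_def distrib_right add_divide_distrib)
  qed (simp add: complex_eq_iff)
qed

text \<open>
  The Schwarz formula on circles of radius \<open>r n \<rightarrow> 1\<close> represents \<open>p (r n * z)\<close> by probability measures
  (after division by \<open>Re (p 0)\<close>) in the angular variable \<open>t \<in> {0..1}\<close>. They are tight, so Helly's
  theorem provides a weak limit along a subsequence, and the kernel, being bounded and continuous in \<open>t\<close> for
  fixed \<open>z\<close>, passes to the limit.
\<close>

theorem herglotz_representation:
  assumes p: "p holomorphic_on unit_disc" and pos: "\<And>z. z \<in> unit_disc \<Longrightarrow> 0 < Re (p z)"
  obtains \<mu> where "sets \<mu> = sets (restrict_space borel unit_circle)" "finite_measure \<mu>"
    "\<And>z. z \<in> unit_disc \<Longrightarrow> p z = \<i> * Im (p 0) + (\<integral>\<zeta>. herglotz_kernel \<zeta> z \<partial>\<mu>)"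
proof -
  define c where "c = Re (p 0)"
  have c: "c > 0" using pos[of 0] by (simp add: c_def)
  define e :: "real \<Rightarrow> complex" where "e = (\<lambda>t. cis (2 * pi * t))"
  have e_cont: "continuous_on A e" for A
    unfolding e_def by (intro continuous_intros)
  have [measurable]: "e \<in> borel_measurable borel"
    using e_cont by (rule borel_measurable_continuous_onI)
  have norm_e [simp]: "cmod (e t) = 1" for t by (simp add: e_def)
  define r :: "nat \<Rightarrow> real" where "r n = 1 - 1 / (real n + 2)" for n
  have r: "0 < r n" "r n < 1" for n by (auto simp: r_def field_simps)
  have r_lim: "r \<longlonglongrightarrow> 1"
    unfolding r_def by real_asymp
  have rD: "r n * z \<in> unit_disc" if "cmod z \<le> 1" for n and z :: complex
    using le_less_trans[OF mult_left_le[OF that] r(2)[of n]] r[of n] by (simp add: norm_mult)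
  define q where "q n z = p (r n * z)" for n and z :: complex
  have q: "q n holomorphic_on cball 0 1" for n
    unfolding q_def by (rule holomorphic_on_compose_gen[OF _ p, unfolded o_def])
      (use rD in \<open>auto intro!: holomorphic_intros\<close>)
  define f where "f n t = indicator {0..1} t * (Re (q n (e t)) / c)" for n t
  have q_cont: "continuous_on {0..1} (\<lambda>t. q n (e t))" for n
    by (rule continuous_on_compose2[OF holomorphic_on_imp_continuous_on[OF q] e_cont]) auto
  have f_pos: "0 \<le> f n t" for n t
    using pos[OF rD, of "e t" n] c by (auto simp: f_def q_def indicator_def)
  have int_f: "set_integrable lborel {0..1} (\<lambda>t. (Re (q n (e t)) / c) *\<^sub>R h t)"
    if "continuous_on {0..1} h" for n and h :: "real \<Rightarrow> complex"
    unfolding set_integrable_def using c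
    by (intro borel_integrable_compact) (auto intro!: continuous_intros q_cont that)
  have [measurable]: "f n \<in> borel_measurable borel" for n
    unfolding f_def using c
    by (intro borel_measurable_continuous_on_indicator[where 'b=real, unfolded real_scaleR_def])
       (auto intro!: continuous_intros q_cont)
  have f_eq: "(\<integral>t. f n t *\<^sub>R h t \<partial>lborel) = I /\<^sub>R c"
    if "continuous_on {0..1} h" "((\<lambda>t. Re (q n (e t)) *\<^sub>R h t) has_integral I) {0..1}"
    for n h and I :: complex
  proof -
    have "(\<integral>t. f n t *\<^sub>R h t \<partial>lborel) = set_lebesgue_integral lborel {0..1} (\<lambda>t. (Re (q n (e t)) / c) *\<^sub>R h t)"
      unfolding set_lebesgue_integral_def f_def by simp
    also have "\<dots> = integral {0..1} (\<lambda>t. (Re (q n (e t)) / c) *\<^sub>R h t)"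
      by (rule set_borel_integral_eq_integral(2)[OF int_f[OF that(1)]])
    also have "\<dots> = I /\<^sub>R c"
      using has_integral_cmul[OF that(2), of "inverse c"]
      by (intro integral_unique) (simp add: divide_inverse mult_ac)
    finally show ?thesis .
  qed
  (* The harmonic densities on the circles of radius r n, as probability measures in the angle. *)
  define M where "M n = density lborel (\<lambda>t. ennreal (f n t))" for n
  have int_M: "(\<integral>t. h t \<partial>M n) = I /\<^sub>R c"
    if [measurable]: "h \<in> borel_measurable borel" and
       "continuous_on {0..1} h" "((\<lambda>t. Re (q n (e t)) *\<^sub>R h t) has_integral I) {0..1}"
    for n h and I :: complex
    unfolding M_def using f_eq[OF that(2,3)] f_pos by (simp add: integral_density)
  have int_M1: "emeasure (M n) {0..1} = 1" "emeasure (M n) UNIV = 1" for n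
  proof -
    have "((\<lambda>t. Re (q n (e t)) *\<^sub>R 1) has_integral c) {0..1}"
      using has_integral_Re[OF schwarz_integral_formula[OF q, of 0 n]] by (simp add: e_def c_def q_def herglotz_kernel_def)
    then have "((\<lambda>t. of_real (Re (q n (e t))) :: complex) has_integral of_real c) {0..1}"
      by (intro has_integral_of_real) simp
    then have *: "(\<integral>t. f n t *\<^sub>R (1::complex) \<partial>lborel) = 1"
      using f_eq[of "\<lambda>_. 1" n "of_real c"] c by (simp add: scaleR_conv_of_real)
    have "(\<lambda>t. f n t *\<^sub>R (1::complex)) = (\<lambda>t. of_real (f n t))"
      by (auto simp: scaleR_conv_of_real)
    with * have **: "(\<integral>t. f n t \<partial>lborel) = 1"
      by simp
    then have "integrable lborel (f n)"
      using not_integrable_integral_eq by fastforce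
    then have "(\<integral>\<^sup>+t. f n t \<partial>lborel) = 1"
      using ** f_pos by (simp add: nn_integral_eq_integral)
    moreover have "f n t * indicator {0..1} t = f n t" for t
      by (simp add: f_def indicator_def)
    then have "ennreal (f n t) * indicator {0..1} t = ennreal (f n t)" for t
      by (metis ennreal_indicator ennreal_mult' f_pos ennreal_mult'')
    ultimately show "emeasure (M n) {0..1} = 1" "emeasure (M n) UNIV = 1"
      by (simp_all add: M_def emeasure_density)
  qed
  have M: "real_distribution (M n)" for n
    by (intro real_distribution.intro prob_spaceI real_distribution_axioms.intro)
       (auto simp: int_M1 M_def[THEN arg_cong[where f=sets]] M_def[THEN arg_cong[where f=space]])
  have "tight M"
    unfolding tight_def
  proof (intro conjI allI impI M)
    fix \<epsilon> :: real assume "\<epsilon> > 0"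
    have "measure (M n) {-1<..1} > 1 - \<epsilon>" for n
    proof -
      interpret real_distribution "M n" by (rule M)
      have "1 = measure (M n) {0..1}"
        using int_M1(1)[of n] by (simp add: measure_def)
      also have "\<dots> \<le> measure (M n) {-1<..1}"
        by (intro finite_measure_mono) auto
      finally show ?thesis using \<open>\<epsilon> > 0\<close> by simp
    qed
    then show "\<exists>a b. a < b \<and> (\<forall>n. 1 - \<epsilon> < measure (M n) {a<..b})"
      by (intro exI[of _ "-1"] exI[of _ 1]) auto
  qed
  from tight_imp_convergent_subsubsequence[OF this strict_mono_id]
  obtain s N where s: "strict_mono s" and N: "real_distribution N" and conv: "weak_conv_m (M \<circ> s) N"
    by auto
  interpret N: real_distribution N by (rule N)
  (* Every test function below is the composition with e of a function on the circle, so the limit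
     may be wrapped around the circle wherever its mass lies. *)
  define \<mu> where "\<mu> = distr (scale_measure (ennreal c) N) (restrict_space borel unit_circle) e"
  have e_meas [measurable]: "e \<in> measurable (scale_measure (ennreal c) N) (restrict_space borel unit_circle)"
  proof (rule measurable_restrict_space2)
    have "measurable (scale_measure (ennreal c) N) borel = borel_measurable (borel :: real measure)"
      by (rule measurable_cong_sets) simp_all
    then show "e \<in> borel_measurable (scale_measure (ennreal c) N)"
      by simp
  qed simp
  show ?thesis
  proof
    show "sets \<mu> = sets (restrict_space borel unit_circle)"
      by (simp add: \<mu>_def)
    show "finite_measure \<mu>"
      unfolding \<mu>_def
      by (intro finite_measure.finite_measure_distr finite_measureI e_meas)
         (simp add: space_scale_measure N.emeasure_space_1 ennreal_mult_eq_top_iff)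
  next
    fix z assume z: "z \<in> unit_disc"
    have ne: "e t - z \<noteq> 0" for t
      using z norm_e[of t] by (metis eq_iff_diff_eq_0 less_irrefl mem_ball_0)
    define h where "h t = herglotz_kernel (e t) z" for t
    have h_cont: "continuous_on A h" for A
      unfolding h_def herglotz_kernel_def by (intro continuous_intros e_cont) (use ne in auto)
    have [measurable]: "h \<in> borel_measurable borel"
      using h_cont by (rule borel_measurable_continuous_onI)
    have h_bound: "cmod (h t) \<le> 2 / (1 - cmod z)" for t
      unfolding h_def using z by (intro herglotz_kernel_bound) auto
    have L1: "(\<lambda>n. integral\<^sup>L ((M \<circ> s) n) h) \<longlonglongrightarrow> integral\<^sup>L N h"
      by (rule weak_conv_imp_integral_bdd_continuous_conv[OF _ N conv])
         (use h_bound M h_cont[of UNIV] in \<open>auto simp: continuous_on_eq_continuous_at\<close>)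
    have L2: "integral\<^sup>L ((M \<circ> s) n) h = (p (r (s n) * z) - \<i> * Im (p 0)) /\<^sub>R c" for n
    proof -
      have "((\<lambda>t. Re (q (s n) (e t)) *\<^sub>R h t) has_integral p (r (s n) * z) - \<i> * Im (p 0)) {0..1}"
        using schwarz_integral_formula[OF q, of z "s n"] z by (simp add: h_def e_def q_def)
      from int_M[OF _ h_cont this] show ?thesis by simp
    qed
    have L3: "(\<lambda>n. (p (r (s n) * z) - \<i> * Im (p 0)) /\<^sub>R c) \<longlonglongrightarrow> (p (1 * z) - \<i> * Im (p 0)) /\<^sub>R c"
    proof -
      have "isCont p z"
        using holomorphic_on_imp_continuous_on[OF p] z continuous_on_eq_continuous_at[OF open_ball] by blast
      moreover have "(\<lambda>n. r (s n) * z) \<longlonglongrightarrow> complex_of_real 1 * z"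
        by (intro tendsto_intros LIMSEQ_subseq_LIMSEQ[OF r_lim s, unfolded o_def])
      ultimately have "(\<lambda>n. p (r (s n) * z)) \<longlonglongrightarrow> p (1 * z)"
        using isCont_tendsto_compose[of "1 * z" p] by simp
      then show ?thesis by (intro tendsto_intros)
    qed
    have "(p (1 * z) - \<i> * Im (p 0)) /\<^sub>R c = integral\<^sup>L N h"
      by (rule LIMSEQ_unique[OF L3 L1[unfolded L2]])
    then have "p z - \<i> * Im (p 0) = c *\<^sub>R integral\<^sup>L N h"
      using c by (simp flip: \<open>_ = integral\<^sup>L N h\<close>)
    also have "\<dots> = (\<integral>\<zeta>. herglotz_kernel \<zeta> z \<partial>\<mu>)"
    proof -
      have "(\<lambda>\<zeta>. herglotz_kernel \<zeta> z) \<in> borel_measurable (restrict_space borel unit_circle)"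
        unfolding herglotz_kernel_def by (intro borel_measurable_continuous_on_restrict continuous_intros)
           (use z in auto)
      then have "(\<integral>\<zeta>. herglotz_kernel \<zeta> z \<partial>\<mu>) = integral\<^sup>L (scale_measure (ennreal c) N) h"
        unfolding \<mu>_def h_def by (subst integral_distr[OF e_meas]) auto
      also have "scale_measure (ennreal c) N = density N (\<lambda>_. ennreal c)"
        by (rule measure_eqI) (auto simp: emeasure_density nn_integral_cmult)
      also have "integral\<^sup>L \<dots> h = c *\<^sub>R integral\<^sup>L N h"
        using c by (subst integral_density) auto
      finally show ?thesis by simp
    qed
    finally show "p z = \<i> * Im (p 0) + (\<integral>\<zeta>. herglotz_kernel \<zeta> z \<partial>\<mu>)"
      by (simp add: algebra_simps)
  qed
qed

section \<open>The lemmas of Schwarz--Pick and Wolff\<close>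

lemma moebius_identity:
  "(cmod (1 - cnj w * z))\<^sup>2 - (cmod (z - w))\<^sup>2 = (1 - (cmod z)\<^sup>2) * (1 - (cmod w)\<^sup>2)"
  unfolding cmod_power2 by (simp add: power2_eq_square algebra_simps)

lemma moebius_denominator_nonzero:
  assumes "cmod z < 1" "cmod w \<le> 1"
  shows "1 - cnj w * z \<noteq> 0"
proof
  assume "1 - cnj w * z = 0"
  then have "cmod (cnj w * z) = 1" by simp
  then have "cmod z * cmod w = 1" by (simp add: norm_mult mult.commute)
  with mult_left_le[OF assms(2), of "cmod z"] assms(1) show False by simp
qed

text \<open>
  Conjugate with the disc automorphisms that move \<open>w\<close> and \<open>f w\<close> to the origin, and apply Schwarz's
  lemma.
\<close>

theorem schwarz_pick:
  assumes f: "f holomorphic_on unit_disc" "f ` unit_disc \<subseteq> unit_disc"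
    and zw: "z \<in> unit_disc" "w \<in> unit_disc"
  shows "cmod ((f z - f w) / (1 - cnj (f w) * f z)) \<le> cmod ((z - w) / (1 - cnj w * z))"
proof -
  define h where "h = Moebius_function 0 (f w) \<circ> (f \<circ> Moebius_function 0 (- w))"
  have M: "Moebius_function 0 a ` unit_disc \<subseteq> unit_disc" if "cmod a < 1" for a
    using Moebius_function_norm_lt_1[OF that] by auto
  have fw: "cmod (f w) < 1" and w: "cmod (- w) < 1"
    using f zw by (auto simp: image_subset_iff)
  have "h holomorphic_on unit_disc"
    unfolding h_def
    by (intro holomorphic_on_compose_gen[where t = unit_disc] Moebius_function_holomorphic f fw w)
       (use M[OF w] f(2) in auto)
  moreover have "h 0 = 0"
    by (simp add: h_def Moebius_function_of_zero Moebius_function_eq_zero)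
  moreover have "cmod (h \<zeta>) < 1" if "cmod \<zeta> < 1" for \<zeta>
    using that M[OF w] M[OF fw] f(2) by (fastforce simp: h_def)
  ultimately have "cmod (h (Moebius_function 0 w z)) \<le> cmod (Moebius_function 0 w z)"
    using zw by (intro Schwarz_Lemma) (auto intro: Moebius_function_norm_lt_1)
  then show ?thesis
    using Moebius_function_compose[of "- w" w z] zw by (simp add: h_def Moebius_function_simple)
qed

text \<open>
  The complementary form, in terms of one minus the squared pseudohyperbolic distance. Both factors
  that vanish at the boundary are visible here, so that \<open>w\<close> can be sent to a boundary point.
\<close>

corollary schwarz_pick':
  assumes f: "f holomorphic_on unit_disc" "f ` unit_disc \<subseteq> unit_disc"
    and zw: "z \<in> unit_disc" "w \<in> unit_disc"
  shows "(1 - (cmod z)\<^sup>2) * (1 - (cmod w)\<^sup>2) / (cmod (1 - cnj w * z))\<^sup>2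
      \<le> (1 - (cmod (f z))\<^sup>2) * (1 - (cmod (f w))\<^sup>2) / (cmod (1 - cnj (f w) * f z))\<^sup>2"
proof -
  have eq: "(1 - (cmod a)\<^sup>2) * (1 - (cmod b)\<^sup>2) / (cmod (1 - cnj b * a))\<^sup>2
      = 1 - (cmod ((a - b) / (1 - cnj b * a)))\<^sup>2" if "a \<in> unit_disc" "b \<in> unit_disc" for a b
    using moebius_denominator_nonzero[of a b] that
    unfolding moebius_identity[symmetric] norm_divide power_divide
    by (simp add: diff_divide_distrib)
  show ?thesis
    using schwarz_pick[OF assms] zw f(2)
    by (subst (1 2) eq) (auto intro!: power_mono simp: image_subset_iff)
qed

text \<open>
  Horodiscs at the limit of the orbit \<open>Z n\<close> of \<open>w\<close> are invariant. Since \<open>|Z n| \<rightarrow> 1\<close>, there are infinitely many \<open>n\<close>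
  with \<open>|Z n| \<le> |Z (n+1)|\<close>. For those, Schwarz--Pick between \<open>z\<close> and \<open>Z n\<close> loses nothing when the factors
  \<open>1 - |Z n|\<^sup>2\<close> and \<open>1 - |Z (n+1)|\<^sup>2\<close> are cancelled, and the limit \<open>Z n \<rightarrow> \<tau>\<close> turns the remaining quotients
  into Poisson kernels at \<open>\<tau>\<close>.
\<close>

theorem wolff_lemma:
  assumes g: "g holomorphic_on unit_disc" "g ` unit_disc \<subseteq> unit_disc"
    and \<tau>: "cmod \<tau> = 1" and w: "w \<in> unit_disc" and lim: "(\<lambda>n. (g ^^ n) w) \<longlonglongrightarrow> \<tau>"
    and z: "z \<in> unit_disc"
  shows "Re (herglotz_kernel \<tau> z) \<le> Re (herglotz_kernel \<tau> (g z))"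
proof -
  define Z where "Z n = (g ^^ n) w" for n
  have limZ: "Z \<longlonglongrightarrow> \<tau>" using lim by (simp add: Z_def[abs_def])
  have Z_Suc: "Z (Suc n) = g (Z n)" for n by (simp add: Z_def)
  have Z: "Z n \<in> unit_disc" for n
    by (induction n) (use w g in \<open>auto simp: Z_def image_subset_iff\<close>)
  have gz: "g z \<in> unit_disc" using g z by blast
  (* Otherwise the moduli would eventually decrease and could not tend to 1. *)
  have "\<exists>n\<ge>N. cmod (Z n) \<le> cmod (Z (Suc n))" for N
  proof (rule ccontr)
    assume "\<not> ?thesis"
    then have dec: "cmod (Z (Suc n)) \<le> cmod (Z n)" if "N \<le> n" for n
      using that by force
    have "cmod (Z n) \<le> cmod (Z N)" if "N \<le> n" for n
      using that by (induction rule: dec_induct) (use dec in force)+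
    moreover have "(\<lambda>n. cmod (Z n)) \<longlonglongrightarrow> cmod \<tau>"
      by (rule tendsto_norm[OF limZ])
    ultimately have "cmod \<tau> \<le> cmod (Z N)"
      by (meson LIMSEQ_le_const2)
    then show False
      using Z[of N] \<tau> by simp
  qed
  then obtain s where s: "\<And>N. N \<le> s N" "\<And>N. cmod (Z (s N)) \<le> cmod (Z (Suc (s N)))"
    by metis
  have s_lim: "filterlim s at_top sequentially"
    by (rule filterlim_at_top_mono[OF filterlim_ident]) (use s(1) in auto)
  have lim1: "(\<lambda>N. Z (s N)) \<longlonglongrightarrow> \<tau>"
    by (rule filterlim_compose[OF limZ s_lim])
  have lim2: "(\<lambda>N. Z (Suc (s N))) \<longlonglongrightarrow> \<tau>"
    by (rule filterlim_compose[OF LIMSEQ_Suc[OF limZ] s_lim])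
  have bd: "(1 - (cmod a)\<^sup>2) / (cmod (1 - cnj \<tau> * a))\<^sup>2 = Re (herglotz_kernel \<tau> a)" for a
  proof -
    have "cmod (1 - cnj \<tau> * a) = cmod \<tau> * cmod (1 - cnj \<tau> * a)" using \<tau> by simp
    also have "\<dots> = cmod (\<tau> - a * (cnj \<tau> * \<tau>))"
      by (simp flip: norm_mult add: algebra_simps)
    also have "cnj \<tau> * \<tau> = 1"
      using \<tau> complex_norm_square[of \<tau>] by (simp add: mult.commute)
    finally show ?thesis
      using Re_herglotz_kernel[OF \<tau>] by simp
  qed
  have "(1 - (cmod z)\<^sup>2) / (cmod (1 - cnj \<tau> * z))\<^sup>2 \<le> (1 - (cmod (g z))\<^sup>2) / (cmod (1 - cnj \<tau> * g z))\<^sup>2"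
  proof (rule LIMSEQ_le)
    show "(\<lambda>N. (1 - (cmod z)\<^sup>2) / (cmod (1 - cnj (Z (s N)) * z))\<^sup>2) \<longlonglongrightarrow> (1 - (cmod z)\<^sup>2) / (cmod (1 - cnj \<tau> * z))\<^sup>2"
      using moebius_denominator_nonzero[of z \<tau>] z \<tau> by (intro tendsto_intros lim1) auto
    show "(\<lambda>N. (1 - (cmod (g z))\<^sup>2) / (cmod (1 - cnj (Z (Suc (s N))) * g z))\<^sup>2) \<longlonglongrightarrow> (1 - (cmod (g z))\<^sup>2) / (cmod (1 - cnj \<tau> * g z))\<^sup>2"
      using moebius_denominator_nonzero[of "g z" \<tau>] gz \<tau> by (intro tendsto_intros lim2) auto
    have "(1 - (cmod z)\<^sup>2) / (cmod (1 - cnj (Z (s N)) * z))\<^sup>2 \<le> (1 - (cmod (g z))\<^sup>2) / (cmod (1 - cnj (Z (Suc (s N))) * g z))\<^sup>2" for N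
    proof -
      define a where "a = 1 - (cmod (Z (s N)))\<^sup>2"
      define b where "b = 1 - (cmod (Z (Suc (s N))))\<^sup>2"
      define X where "X = (1 - (cmod z)\<^sup>2) / (cmod (1 - cnj (Z (s N)) * z))\<^sup>2"
      define Y where "Y = (1 - (cmod (g z))\<^sup>2) / (cmod (1 - cnj (Z (Suc (s N))) * g z))\<^sup>2"
      have "0 < a" using Z[of "s N"] by (simp add: a_def power_less_one_iff)
      have "b \<le> a" using s(2)[of N] by (simp add: a_def b_def power_mono)
      have "0 \<le> Y" using gz by (simp add: Y_def power_le_one)
      have "X * a \<le> Y * b"
        using schwarz_pick'[OF g z Z[of "s N"]] by (simp add: X_def Y_def a_def b_def Z_Suc mult_ac)
      also have "\<dots> \<le> Y * a"
        using \<open>b \<le> a\<close> \<open>0 \<le> Y\<close> by (rule mult_left_mono)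
      finally have "X \<le> Y"
        using \<open>0 < a\<close> by simp
      then show ?thesis
        by (simp add: X_def Y_def)
    qed
    then show "\<exists>N0. \<forall>N\<ge>N0. (1 - (cmod z)\<^sup>2) / (cmod (1 - cnj (Z (s N)) * z))\<^sup>2 \<le> (1 - (cmod (g z))\<^sup>2) / (cmod (1 - cnj (Z (Suc (s N))) * g z))\<^sup>2"
      by blast
  qed
  then show ?thesis unfolding bd .
qed

section \<open>The atom at the Denjoy--Wolff point\<close>

text \<open>
  For \<open>\<zeta> \<noteq> \<tau>\<close> the integrand, with its factor \<open>1 - r\<close>, tends to \<open>0\<close>; for \<open>\<zeta> = \<tau>\<close> it equals \<open>1 + r\<close>;
  and it is dominated by \<open>2\<close>.
\<close>

lemma herglotz_point_mass:
  fixes r :: "nat \<Rightarrow> real" and \<tau> :: complex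
  assumes \<mu>: "finite_measure \<mu>" "sets \<mu> = sets (restrict_space borel unit_circle)"
    and \<tau>: "cmod \<tau> = 1" and r: "\<And>n. 0 \<le> r n" "\<And>n. r n < 1" "r \<longlonglongrightarrow> 1"
  shows "(\<lambda>n. (1 - r n) *\<^sub>R (\<integral>\<zeta>. herglotz_kernel \<zeta> (r n * \<tau>) \<partial>\<mu>)) \<longlonglongrightarrow> of_real (2 * measure \<mu> {\<tau>})"
proof -
  interpret finite_measure \<mu> by fact
  have sp: "space \<mu> = unit_circle" using sets_eq_imp_space_eq[OF \<mu>(2)] by (simp add: space_restrict_space)
  have \<tau>0: "\<tau> \<noteq> 0" using \<tau> by auto
  have rD: "r n * \<tau> \<in> unit_disc" for n using r \<tau> by (simp add: norm_mult)
  have \<tau>s [measurable]: "{\<tau>} \<in> sets \<mu>" using \<tau> by (simp add: \<mu>(2) sets_restrict_space_iff)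
  have "(\<lambda>n. \<integral>\<zeta>. (1 - r n) *\<^sub>R herglotz_kernel \<zeta> (r n * \<tau>) \<partial>\<mu>)
      \<longlonglongrightarrow> (\<integral>\<zeta>. indicator {\<tau>} \<zeta> *\<^sub>R 2 \<partial>\<mu>)"
  proof (rule integral_dominated_convergence[where w = "\<lambda>_. 2"])
    show "(\<lambda>\<zeta>. (1 - r n) *\<^sub>R herglotz_kernel \<zeta> (r n * \<tau>)) \<in> borel_measurable \<mu>" for n
      using integrable_herglotz_kernel[OF \<mu> subset_refl rD[of n]]
      by (intro borel_measurable_scaleR borel_measurable_const) auto
    show "AE \<zeta> in \<mu>. norm ((1 - r n) *\<^sub>R herglotz_kernel \<zeta> (r n * \<tau>)) \<le> 2" for n
    proof (rule AE_I2)
      fix \<zeta> assume "\<zeta> \<in> space \<mu>"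
      then have "cmod (herglotz_kernel \<zeta> (r n * \<tau>)) \<le> 2 / (1 - r n)"
        using herglotz_kernel_bound[of \<zeta> "r n * \<tau>"] rD[of n] r(1)[of n] \<tau> by (simp add: sp norm_mult)
      then show "norm ((1 - r n) *\<^sub>R herglotz_kernel \<zeta> (r n * \<tau>)) \<le> 2"
        using r(2)[of n] by (simp add: pos_le_divide_eq mult.commute)
    qed
    show "AE \<zeta> in \<mu>. (\<lambda>n. (1 - r n) *\<^sub>R herglotz_kernel \<zeta> (r n * \<tau>)) \<longlonglongrightarrow> indicator {\<tau>} \<zeta> *\<^sub>R 2"
    proof (rule AE_I2)
      fix \<zeta> assume "\<zeta> \<in> space \<mu>"
      show "(\<lambda>n. (1 - r n) *\<^sub>R herglotz_kernel \<zeta> (r n * \<tau>)) \<longlonglongrightarrow> indicator {\<tau>} \<zeta> *\<^sub>R 2"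
      proof (cases "\<zeta> = \<tau>")
        case True
        have "(1 - r n) *\<^sub>R herglotz_kernel \<zeta> (r n * \<tau>) = of_real (1 + r n)" for n
        proof -
          have "herglotz_kernel \<zeta> (r n * \<tau>) = (\<tau> * of_real (1 + r n)) / (\<tau> * of_real (1 - r n))"
            by (simp add: True herglotz_kernel_def algebra_simps)
          also have "\<dots> = of_real ((1 + r n) / (1 - r n))"
            using \<tau>0 by simp
          finally have K: "herglotz_kernel \<zeta> (r n * \<tau>) = of_real ((1 + r n) / (1 - r n))" .
          show ?thesis
            unfolding K scaleR_conv_of_real of_real_mult[symmetric] using r(2)[of n] by simp
        qed
        moreover have "(\<lambda>n. of_real (1 + r n) :: complex) \<longlonglongrightarrow> of_real (1 + 1)"
          by (intro tendsto_intros r)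
        ultimately show ?thesis using True by simp
      next
        case False
        have "(\<lambda>n. (1 - r n) *\<^sub>R herglotz_kernel \<zeta> (r n * \<tau>)) \<longlonglongrightarrow> (1 - 1) *\<^sub>R herglotz_kernel \<zeta> (of_real 1 * \<tau>)"
          unfolding herglotz_kernel_def using False by (intro tendsto_intros r) auto
        then show ?thesis using False by simp
      qed
    qed
  qed auto
  then show ?thesis
    by (simp add: scaleR_conv_of_real mult.commute)
qed

text \<open>
  The radius lies in a Stolz region, so the angular limit of the derivative controls the difference
  quotients by the mean value inequality.
\<close>

lemma radial_difference_quotient:
  fixes r :: "nat \<Rightarrow> real" and \<tau> :: complex
  assumes g: "g holomorphic_on unit_disc" and lim: "(deriv g \<longlongrightarrow> c) (angular_at \<tau>)" and \<tau>: "cmod \<tau> = 1"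
    and r: "\<And>n. 0 \<le> r n" "\<And>n. r n < 1" "r \<longlonglongrightarrow> 1" and gr: "(\<lambda>n. g (r n * \<tau>)) \<longlonglongrightarrow> \<tau>"
  shows "(\<lambda>n. (\<tau> - g (r n * \<tau>)) / (1 - r n)) \<longlonglongrightarrow> c * \<tau>"
proof (rule tendstoI)
  fix e :: real assume "e > 0"
  define \<epsilon> where "\<epsilon> = e / 2"
  have \<epsilon>: "\<epsilon> > 0" using \<open>e > 0\<close> by (simp add: \<epsilon>_def)
  have dist: "dist (t * \<tau>) \<tau> = 1 - t" if "t \<le> 1" for t :: real
  proof -
    have "t * \<tau> - \<tau> = of_real (t - 1) * \<tau>" by (simp add: algebra_simps)
    then show ?thesis using that \<tau> by (simp add: dist_norm norm_mult del: of_real_diff)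
  qed
  have stolz: "t * \<tau> \<in> stolz_region \<tau> 2" "t * \<tau> \<in> unit_disc" "t * \<tau> \<noteq> \<tau>" if "0 \<le> t" "t < 1" for t :: real
    using that \<tau> dist[of t] by (auto simp: stolz_region_def norm_mult simp flip: dist_norm)
  have "(deriv g \<longlongrightarrow> c) (at \<tau> within stolz_region \<tau> 2)"
    using lim by (simp add: tendsto_angular_at_iff)
  from tendstoD[OF this \<epsilon>] obtain \<delta> where \<delta>: "\<delta> > 0"
    "\<And>z. z \<in> stolz_region \<tau> 2 \<Longrightarrow> z \<noteq> \<tau> \<Longrightarrow> dist z \<tau> < \<delta> \<Longrightarrow> dist (deriv g z) c < \<epsilon>"
    by (auto simp: eventually_at)
  (* Near \<tau> the derivative of h is small on the radius, so h varies little there; letting the outer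
     endpoint tend to \<tau> compares h with its radial limit \<tau> - c \<tau>. *)
  define h where "h z = g z - c * z" for z
  have h: "cmod (h (r n * \<tau>) - (\<tau> - c * \<tau>)) \<le> \<epsilon> * (1 - r n)" if n: "1 - r n < \<delta>" for n
  proof (rule LIMSEQ_le_const2)
    have "(\<lambda>m. h (r m * \<tau>)) \<longlonglongrightarrow> \<tau> - c * (of_real 1 * \<tau>)"
      unfolding h_def by (intro tendsto_intros r gr)
    then show "(\<lambda>m. cmod (h (r n * \<tau>) - h (r m * \<tau>))) \<longlonglongrightarrow> cmod (h (r n * \<tau>) - (\<tau> - c * \<tau>))"
      by (intro tendsto_intros) simp
    have "\<forall>\<^sub>F m in sequentially. r n < r m"
      by (rule order_tendstoD(1)[OF r(3) r(2)])
    then obtain m0 where m0: "\<And>m. m0 \<le> m \<Longrightarrow> r n < r m"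
      by (auto simp: eventually_sequentially)
    have "cmod (h (r n * \<tau>) - h (r m * \<tau>)) \<le> \<epsilon> * (1 - r n)" if "m0 \<le> m" for m
    proof -
      let ?S = "closed_segment (r n * \<tau>) (r m * \<tau>)"
      have S: "z \<in> unit_disc \<and> cmod (deriv g z - c) \<le> \<epsilon>" if "z \<in> ?S" for z
      proof -
        from that obtain u where u: "0 \<le> u" "u \<le> 1" "z = (1 - u) *\<^sub>R (r n * \<tau>) + u *\<^sub>R (r m * \<tau>)"
          by (auto simp: closed_segment_def)
        define t where "t = (1 - u) * r n + u * r m"
        have z: "z = t * \<tau>" by (simp add: u(3) t_def scaleR_conv_of_real algebra_simps)
        have "t = r n + u * (r m - r n)" by (simp add: t_def algebra_simps)
        moreover have "u * (r m - r n) \<le> r m - r n" "0 \<le> u * (r m - r n)"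
          using m0[OF \<open>m0 \<le> m\<close>] u by (auto intro: mult_left_le_one_le)
        ultimately have t: "r n \<le> t" "t \<le> r m" by auto
        have t': "0 \<le> t" "t < 1" using t r(1)[of n] r(2)[of m] by linarith+
        have "dist (deriv g z) c < \<epsilon>"
          unfolding z by (rule \<delta>(2)) (use stolz[OF t'] t t' n dist[of t] in auto)
        then show ?thesis
          using stolz(2)[OF t'] z by (simp add: dist_norm)
      qed
      have "cmod (h (r m * \<tau>) - h (r n * \<tau>)) \<le> \<epsilon> * cmod (r m * \<tau> - r n * \<tau>)"
      proof (rule field_differentiable_bound[where S = ?S])
        fix z assume z: "z \<in> ?S"
        have "(g has_field_derivative deriv g z) (at z)"
          using g S[OF z] by (intro holomorphic_derivI[of g unit_disc]) auto
        then have "(h has_field_derivative (deriv g z - c)) (at z)"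
          unfolding h_def by (auto intro!: derivative_eq_intros)
        then show "(h has_field_derivative (deriv g z - c)) (at z within ?S)"
          by (rule has_field_derivative_at_within)
        show "cmod (deriv g z - c) \<le> \<epsilon>" using S[OF z] by blast
      qed auto
      also have "cmod (r m * \<tau> - r n * \<tau>) = r m - r n"
      proof -
        have "r m * \<tau> - r n * \<tau> = of_real (r m - r n) * \<tau>" by (simp add: algebra_simps)
        then show ?thesis using \<tau> m0[OF that] by (simp add: norm_mult del: of_real_diff)
      qed
      also have "\<epsilon> * (r m - r n) \<le> \<epsilon> * (1 - r n)"
        using \<epsilon> r(2)[of m] by (intro mult_left_mono) auto
      finally show ?thesis by (simp add: norm_minus_commute)
    qed
    then show "\<exists>N. \<forall>m\<ge>N. cmod (h (r n * \<tau>) - h (r m * \<tau>)) \<le> \<epsilon> * (1 - r n)"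
      by blast
  qed
  have "\<forall>\<^sub>F n in sequentially. 1 - \<delta> < r n"
    by (rule order_tendstoD(1)[OF r(3)]) (use \<delta> in auto)
  then show "\<forall>\<^sub>F n in sequentially. dist ((\<tau> - g (r n * \<tau>)) / (1 - r n)) (c * \<tau>) < e"
  proof eventually_elim
    case (elim n)
    define d where "d = 1 - r n"
    have d: "d > 0" using r(2) by (simp add: d_def)
    have r_eq: "complex_of_real (r n) = 1 - of_real d" by (simp add: d_def)
    have "(\<tau> - g (r n * \<tau>)) / of_real d - c * \<tau> = (\<tau> - g (r n * \<tau>) - of_real d * (c * \<tau>)) / of_real d"
      using d by (simp add: diff_divide_distrib)
    also have "\<tau> - g (r n * \<tau>) - of_real d * (c * \<tau>) = - (h (r n * \<tau>) - (\<tau> - c * \<tau>))"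
      by (simp add: h_def r_eq algebra_simps)
    finally have "dist ((\<tau> - g (r n * \<tau>)) / of_real d) (c * \<tau>) = cmod (h (r n * \<tau>) - (\<tau> - c * \<tau>)) / d"
      using d by (simp add: dist_norm norm_divide norm_minus_commute)
    also have "\<dots> \<le> \<epsilon>"
      using h[of n] elim d by (simp add: d_def pos_divide_le_eq)
    finally show ?case
      using \<open>e > 0\<close> by (simp add: \<epsilon>_def d_def)
  qed
qed

theorem hyperbolic_herglotz_rep_exists:
  assumes hyp: "hyperbolic_self_map g \<tau> \<alpha>"
  shows "\<exists>b \<sigma>. finite_borel_measure_on (unit_circle - {\<tau>}) \<sigma> \<and> herglotz_rep g \<tau> \<alpha> b \<sigma>"
proof -
  from hyp have g: "g holomorphic_on unit_disc" "g ` unit_disc \<subseteq> unit_disc"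
    and \<tau>: "cmod \<tau> = 1" and dw: "(\<lambda>n. (g ^^ n) 0) \<longlonglongrightarrow> \<tau>"
    and lim: "(deriv g \<longlongrightarrow> of_real \<alpha>) (angular_at \<tau>)" and \<alpha>: "0 < \<alpha>"
    by (auto simp: hyperbolic_self_map_def denjoy_wolff_point_def)
  have \<tau>0: "\<tau> \<noteq> 0" using \<tau> by auto
  have gD: "g z \<in> unit_disc" if "z \<in> unit_disc" for z using g that by blast
  have g_ne: "\<tau> \<noteq> g z" if "z \<in> unit_disc" for z
    using gD[OF that] \<tau> by auto
  define p where "p z = herglotz_kernel \<tau> (g z)" for z
  have p: "p holomorphic_on unit_disc"
    unfolding p_def herglotz_kernel_def using g_ne by (intro holomorphic_intros g) auto
  obtain \<mu> where \<mu>: "sets \<mu> = sets (restrict_space borel unit_circle)" "finite_measure \<mu>"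
    and p_eq: "\<And>z. z \<in> unit_disc \<Longrightarrow> p z = \<i> * Im (p 0) + (\<integral>\<zeta>. herglotz_kernel \<zeta> z \<partial>\<mu>)"
    using herglotz_representation[OF p] Re_herglotz_kernel_pos[OF \<tau> gD] unfolding p_def by blast
  have sp: "space \<mu> = unit_circle" using sets_eq_imp_space_eq[OF \<mu>(1)] by (simp add: space_restrict_space)
  define r :: "nat \<Rightarrow> real" where "r n = 1 - 1 / (real n + 2)" for n
  have r: "0 \<le> r n" "r n < 1" for n by (auto simp: r_def field_simps)
  have r_lim: "r \<longlonglongrightarrow> 1" unfolding r_def by real_asymp
  have rD: "r n * \<tau> \<in> unit_disc" for n using r[of n] \<tau> by (simp add: norm_mult)
  have dist_r: "cmod (\<tau> - r n * \<tau>) = 1 - r n" for n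
  proof -
    have "\<tau> - r n * \<tau> = of_real (1 - r n) * \<tau>" by (simp add: algebra_simps)
    then show ?thesis using r[of n] \<tau> by (simp add: norm_mult del: of_real_diff)
  qed
  (* Wolff's inequality gives Re p at least (1 + r) / (1 - r) along the radius. *)
  have gr: "(\<lambda>n. g (r n * \<tau>)) \<longlonglongrightarrow> \<tau>"
  proof -
    have bound: "cmod (g (r n * \<tau>) - \<tau>) \<le> 2 * (1 - r n)" for n
    proof -
      have "1 / (1 - r n) \<le> (1 + r n) / (1 - r n)"
        using r[of n] by (intro divide_right_mono) auto
      also have "\<dots> = Re (herglotz_kernel \<tau> (r n * \<tau>))"
        using r[of n] \<tau> unfolding Re_herglotz_kernel[OF \<tau>] dist_r
        by (simp add: norm_mult power2_eq_square divide_simps) (simp add: algebra_simps)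
      also have "\<dots> \<le> Re (p (r n * \<tau>))"
        unfolding p_def by (rule wolff_lemma[OF g \<tau> _ dw rD]) simp
      also have "\<dots> \<le> cmod (p (r n * \<tau>) + 1)"
        using complex_Re_le_cmod[of "p (r n * \<tau>) + 1"] by simp
      also have "p (r n * \<tau>) + 1 = 2 * \<tau> / (\<tau> - g (r n * \<tau>))"
        unfolding p_def by (rule herglotz_kernel_plus_one[OF g_ne[OF rD]])
      also have "cmod \<dots> = 2 / cmod (g (r n * \<tau>) - \<tau>)"
        using \<tau> by (simp add: norm_divide norm_mult norm_minus_commute)
      finally show ?thesis
        using r[of n] g_ne[OF rD, of n] by (simp add: field_simps)
    qed
    have "(\<lambda>n. 2 * (1 - r n)) \<longlonglongrightarrow> 2 * (1 - 1)"
      by (intro tendsto_intros r_lim)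
    then have "(\<lambda>n. 2 * (1 - r n)) \<longlonglongrightarrow> 0"
      by simp
    then have "(\<lambda>n. g (r n * \<tau>) - \<tau>) \<longlonglongrightarrow> 0"
      by (rule Lim_null_comparison[OF always_eventually[OF allI[OF bound]]])
    then show ?thesis by (simp add: LIM_zero_iff)
  qed
  (* The limit of (1 - r) p(r \<tau>), computed from the angular derivative and then from \<mu>. *)
  have "(\<lambda>n. (\<tau> + g (r n * \<tau>)) / ((\<tau> - g (r n * \<tau>)) / (1 - r n))) \<longlonglongrightarrow> (\<tau> + \<tau>) / (\<alpha> * \<tau>)"
    using \<alpha> \<tau>0 by (intro tendsto_intros gr radial_difference_quotient[OF g(1) lim \<tau> r r_lim gr]) auto
  moreover have "(\<tau> + g (r n * \<tau>)) / ((\<tau> - g (r n * \<tau>)) / (1 - r n)) = (1 - r n) *\<^sub>R p (r n * \<tau>)" for n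
    by (simp add: p_def herglotz_kernel_def scaleR_conv_of_real)
  moreover have "(\<tau> + \<tau>) / (\<alpha> * \<tau>) = of_real (2 / \<alpha>)"
    using \<tau>0 by simp
  ultimately have lim1: "(\<lambda>n. (1 - r n) *\<^sub>R p (r n * \<tau>)) \<longlonglongrightarrow> of_real (2 / \<alpha>)"
    by simp
  have "(\<lambda>n. (1 - r n) *\<^sub>R (\<i> * Im (p 0)) + (1 - r n) *\<^sub>R (\<integral>\<zeta>. herglotz_kernel \<zeta> (r n * \<tau>) \<partial>\<mu>))
     \<longlonglongrightarrow> (1 - 1) *\<^sub>R (\<i> * Im (p 0)) + of_real (2 * measure \<mu> {\<tau>})"
    by (intro tendsto_intros r_lim herglotz_point_mass[OF \<mu>(2,1) \<tau> r r_lim])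
  then have lim2: "(\<lambda>n. (1 - r n) *\<^sub>R p (r n * \<tau>)) \<longlonglongrightarrow> of_real (2 * measure \<mu> {\<tau>})"
    by (simp add: p_eq[OF rD] scaleR_add_right)
  have mass: "measure \<mu> {\<tau>} = 1 / \<alpha>"
    using LIMSEQ_unique[OF lim1 lim2] unfolding of_real_eq_iff by simp
  define \<sigma> where "\<sigma> = restrict_space \<mu> (unit_circle - {\<tau>})"
  have \<tau>s: "{\<tau>} \<in> sets \<mu>" using \<tau> by (simp add: \<mu>(1) sets_restrict_space_iff)
  have cs: "unit_circle - {\<tau>} \<in> sets \<mu>"
    using sets.compl_sets[OF \<tau>s] by (simp add: sp)
  have "finite_borel_measure_on (unit_circle - {\<tau>}) \<sigma>"
    unfolding finite_borel_measure_on_def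
  proof
    have "sets \<sigma> = sets (restrict_space (restrict_space borel unit_circle) (unit_circle - {\<tau>}))"
      unfolding \<sigma>_def by (rule sets_restrict_space_cong[OF \<mu>(1)])
    then show "sets \<sigma> = sets (restrict_space borel (unit_circle - {\<tau>}))"
      by (simp add: restrict_restrict_space Int_absorb1)
    show "finite_measure \<sigma>"
      unfolding \<sigma>_def by (rule finite_measure_restrict_space[OF \<mu>(2) cs])
  qed
  moreover have "herglotz_rep g \<tau> \<alpha> (Im (p 0)) \<sigma>"
    unfolding herglotz_rep_def
  proof
    fix z assume z: "z \<in> unit_disc"
    have K: "integrable \<mu> (\<lambda>\<zeta>. herglotz_kernel \<zeta> z)"
      by (rule integrable_herglotz_kernel[OF \<mu>(2,1) subset_refl z])
    have I: "integrable \<mu> (\<lambda>\<zeta>. indicator {\<tau>} \<zeta> *\<^sub>R herglotz_kernel \<tau> z)"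
      using \<tau>s finite_measure.emeasure_finite[OF \<mu>(2)]
      by (intro integrable_scaleR_left integrable_real_indicator) (auto simp: less_top)
    have cs': "(unit_circle - {\<tau>}) \<inter> space \<mu> \<in> sets \<mu>"
      using cs by (simp only: sp Int_absorb2[OF Diff_subset])
    have "(\<integral>\<zeta>. herglotz_kernel \<zeta> z \<partial>\<mu>) =
        (\<integral>\<zeta>. indicator {\<tau>} \<zeta> *\<^sub>R herglotz_kernel \<tau> z + indicator (unit_circle - {\<tau>}) \<zeta> *\<^sub>R herglotz_kernel \<zeta> z \<partial>\<mu>)"
      by (intro Bochner_Integration.integral_cong) (auto simp: sp indicator_def)
    also have "\<dots> = (\<integral>\<zeta>. indicator {\<tau>} \<zeta> *\<^sub>R herglotz_kernel \<tau> z \<partial>\<mu>) + (\<integral>\<zeta>. herglotz_kernel \<zeta> z \<partial>\<sigma>)"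
      unfolding \<sigma>_def integral_restrict_space[OF cs']
      by (rule Bochner_Integration.integral_add[OF I integrable_mult_indicator[OF cs K]])
    also have "(\<integral>\<zeta>. indicator {\<tau>} \<zeta> *\<^sub>R herglotz_kernel \<tau> z \<partial>\<mu>) = 1 / \<alpha> * herglotz_kernel \<tau> z"
      using \<tau>s \<mu>(2) mass by (simp add: scaleR_conv_of_real finite_measure.emeasure_finite less_top)
    finally show "(1 + cnj \<tau> * g z) / (1 - cnj \<tau> * g z) = 1 / complex_of_real \<alpha> * ((1 + cnj \<tau> * z) / (1 - cnj \<tau> * z))
          + \<i> * complex_of_real (Im (p 0)) + (\<integral>\<zeta>. (\<zeta> + z) / (\<zeta> - z) \<partial>\<sigma>)"
      using p_eq[OF z] unfolding herglotz_kernel_cayley[OF \<tau>] by (simp add: p_def herglotz_kernel_def)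
  qed
  ultimately show ?thesis by blast
qed

section \<open>Sums of geometric profiles and the logarithm\<close>

text \<open>
  Each of the indices \<open>n\<close> with \<open>a c\<^sup>n \<ge> x\<close> contributes at least \<open>1/4\<close>, and there are about
  \<open>ln (a / x) / ln (1 / c)\<close> of them. If \<open>x > a\<close> the bound is negative and holds for the empty sum.
\<close>

lemma geometric_lower_sum:
  fixes a c x :: real
  assumes a: "0 < a" and c: "0 < c" "c < 1" and x: "0 < x" and q: "\<And>n. a * c ^ n \<le> q n"
  shows "\<exists>N. ln (a / x) / ln (1 / c) / 4 \<le> (\<Sum>n<N. (q n / (x + q n))\<^sup>2)"
proof -
  define L where "L = ln (a / x) / ln (1 / c)"
  have lc: "0 < ln (1 / c)" using c by simp
  have half: "1 / 4 \<le> (q n / (x + q n))\<^sup>2" if "real n < L" for n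
  proof -
    have "real n * ln (1 / c) \<le> ln (a / x)"
      using that lc by (simp add: L_def pos_less_divide_eq)
    then have "ln ((1 / c) ^ n) \<le> ln (a / x)"
      using c by (simp add: ln_realpow)
    then have "(1 / c) ^ n \<le> a / x"
      using a c x by simp
    then have "x \<le> a * c ^ n"
      using c x by (simp add: field_simps)
    with q[of n] have "x \<le> q n" by simp
    then have "1 / 2 \<le> q n / (x + q n)"
      using x by (simp add: field_simps)
    from power_mono[OF this, of 2] show ?thesis by (simp add: power2_eq_square)
  qed
  let ?N = "nat \<lceil>L\<rceil>"
  have "L / 4 \<le> (\<Sum>n<?N. 1 / 4)"
    by (simp add: real_nat_ceiling_ge)
  also have "\<dots> \<le> (\<Sum>n<?N. (q n / (x + q n))\<^sup>2)"
  proof (intro sum_mono half)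
    fix n assume "n \<in> {..<?N}"
    then show "real n < L" by (simp add: zless_nat_eq_int_zless less_ceiling_iff)
  qed
  finally show ?thesis unfolding L_def by blast
qed

text \<open>
  The terms are at most \<open>1\<close> until \<open>A c\<^sup>n\<close> has dropped to \<open>x\<close>, which takes about \<open>ln (A / x) / ln (1 / c)\<close>
  steps, and decay geometrically afterwards.
\<close>

lemma geometric_upper_sum:
  fixes A c x :: real
  assumes A: "0 < A" and c: "0 < c" "c < 1" and x: "0 < x"
    and q: "\<And>n. 0 < q n" "\<And>n. q n \<le> A * c ^ n"
  shows "(\<Sum>n<N. (q n / (x + q n))\<^sup>2) \<le> \<bar>ln (A / x)\<bar> / ln (1 / c) + 1 + 1 / (1 - c)"
proof -
  define L where "L = \<bar>ln (A / x)\<bar> / ln (1 / c)"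
  (* From index N0 on, A c^n is at most x. *)
  define N0 where "N0 = nat \<lceil>L\<rceil>"
  define s where "s n = q n / (x + q n)" for n
  have lc: "0 < ln (1 / c)" using c by simp
  have L0: "L \<ge> 0" using lc by (simp add: L_def)
  have s: "0 \<le> s n" "s n \<le> 1" "s n \<le> q n / x" for n
    using q(1)[of n] x by (auto simp: s_def field_simps)
  have sq: "(s n)\<^sup>2 \<le> s n" for n
    using s[of n] by (simp add: power2_eq_square mult_left_le)
  have "ln (A / x) \<le> L * ln (1 / c)"
    using lc by (simp add: L_def)
  also have "\<dots> \<le> real N0 * ln (1 / c)"
    using lc by (intro mult_right_mono) (auto simp: N0_def real_nat_ceiling_ge)
  also have "\<dots> = ln ((1 / c) ^ N0)"
    using c by (simp add: ln_realpow)
  finally have "A / x \<le> (1 / c) ^ N0"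
    using A c x by simp
  then have N0: "A * c ^ N0 \<le> x"
    using c x by (simp add: field_simps)
  have tail: "s (N0 + k) \<le> c ^ k" for k
  proof -
    have "q (N0 + k) \<le> (A * c ^ N0) * c ^ k"
      using q(2)[of "N0 + k"] by (simp add: power_add mult_ac)
    also have "\<dots> \<le> x * c ^ k"
      using N0 c by (intro mult_right_mono) auto
    finally show ?thesis
      using s(3)[of "N0 + k"] x by (simp add: field_simps) (metis mult.commute mult_le_cancel_left_pos order_trans)
  qed
  have "(\<Sum>n<N. (s n)\<^sup>2) \<le> (\<Sum>n<N0 + N. s n)"
    using s(1) by (intro order_trans[OF sum_mono[OF sq]] sum_mono2) auto
  also have "\<dots> = (\<Sum>n<N0. s n) + (\<Sum>k<N. s (N0 + k))"
    by (induction N) auto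
  also have "\<dots> \<le> (\<Sum>n<N0. 1) + (\<Sum>k<N. c ^ k)"
    by (intro add_mono sum_mono s tail)
  also have "(\<Sum>k<N. c ^ k) \<le> 1 / (1 - c)"
    using c by (simp add: sum_gp_strict divide_right_mono)
  also have "(\<Sum>n<N0. 1) \<le> L + 1"
    using L0 by (simp add: N0_def of_nat_ceiling)
  finally show ?thesis
    by (simp add: s_def L_def)
qed

text \<open>
  The two pointwise estimates, integrated. In the direction from sums to the logarithm the pointwise
  estimate needs a number of terms that depends on the point, so monotone convergence is applied to the
  supremum of the partial sums. The upper bound \<open>R\<close> for \<open>x\<close> makes the negative part of the logarithm
  harmless.
\<close>

theorem sum_integrals_bounded_iff_log_integrable:
  fixes x :: "'a \<Rightarrow> real" and q :: "nat \<Rightarrow> real"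
  assumes S: "finite_measure S" and x [measurable]: "x \<in> borel_measurable S"
    and x_bd: "\<And>\<zeta>. \<zeta> \<in> space S \<Longrightarrow> 0 < x \<zeta> \<and> x \<zeta> \<le> R"
    and a: "0 < a" and c: "0 < c" "c < 1" and A: "0 < A" and d: "0 < d" "d < 1"
    and q: "\<And>n. a * c ^ n \<le> q n" "\<And>n. q n \<le> A * d ^ n"
  shows "(\<exists>B. \<forall>N. (\<Sum>n<N. \<integral>\<zeta>. (q n / (x \<zeta> + q n))\<^sup>2 \<partial>S) \<le> B) \<longleftrightarrow>
         integrable S (\<lambda>\<zeta>. ln (1 / x \<zeta>))"
proof -
  interpret finite_measure S by (rule S)
  have q0: "0 < q n" for n
    using q(1)[of n] a c by (meson less_le_trans mult_pos_pos zero_less_power)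
  define s where "s n \<zeta> = (q n / (x \<zeta> + q n))\<^sup>2" for n \<zeta>
  have [measurable]: "s n \<in> borel_measurable S" for n
    unfolding s_def by measurable
  have s_bd: "0 \<le> s n \<zeta>" "\<zeta> \<in> space S \<Longrightarrow> s n \<zeta> \<le> 1" for n \<zeta>
    using q0[of n] x_bd[of \<zeta>] by (auto simp: s_def power_le_one_iff)
  have s_int: "integrable S (s n)" for n
    by (rule integrable_const_bound[of _ 1]) (use s_bd in auto)
  have sum_int: "(\<Sum>n<N. integral\<^sup>L S (s n)) = (\<integral>\<zeta>. (\<Sum>n<N. s n \<zeta>) \<partial>S)" for N
    by (simp add: s_int)
  show ?thesis
    unfolding s_def[symmetric]
  proof
    assume "\<exists>B. \<forall>N. (\<Sum>n<N. integral\<^sup>L S (s n)) \<le> B"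
    then obtain B where B: "\<And>N. (\<Sum>n<N. integral\<^sup>L S (s n)) \<le> B" by blast
    define k where "k = ln (1 / c) * 4"
    have k: "0 < k" using c by (simp add: k_def)
    define l where "l \<zeta> = max 0 (ln (a / x \<zeta>) / k)" for \<zeta>
    have [measurable]: "l \<in> borel_measurable S"
      unfolding l_def by measurable
    have "(\<integral>\<^sup>+\<zeta>. ennreal (l \<zeta>) \<partial>S) \<le> (\<integral>\<^sup>+\<zeta>. (SUP N. ennreal (\<Sum>n<N. s n \<zeta>)) \<partial>S)"
    proof (rule nn_integral_mono)
      fix \<zeta> assume "\<zeta> \<in> space S"
      then obtain N where N: "ln (a / x \<zeta>) / k \<le> (\<Sum>n<N. s n \<zeta>)"
        using geometric_lower_sum[OF a c, of "x \<zeta>" q] x_bd[of \<zeta>] q(1)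
        by (auto simp: s_def k_def)
      moreover have "0 \<le> (\<Sum>n<N. s n \<zeta>)"
        by (intro sum_nonneg s_bd)
      ultimately have "l \<zeta> \<le> (\<Sum>n<N. s n \<zeta>)"
        by (simp add: l_def)
      then show "ennreal (l \<zeta>) \<le> (SUP N. ennreal (\<Sum>n<N. s n \<zeta>))"
        by (intro SUP_upper2[of N] ennreal_leI) auto
    qed
    also have "\<dots> = (SUP N. (\<integral>\<^sup>+\<zeta>. ennreal (\<Sum>n<N. s n \<zeta>) \<partial>S))"
      by (intro nn_integral_monotone_convergence_SUP)
         (auto simp: incseq_def le_fun_def intro!: ennreal_leI sum_mono2 s_bd)
    also have "\<dots> \<le> ennreal B"
    proof (rule SUP_least)
      fix N
      have "(\<integral>\<^sup>+\<zeta>. ennreal (\<Sum>n<N. s n \<zeta>) \<partial>S) = ennreal (\<Sum>n<N. integral\<^sup>L S (s n))"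
        unfolding sum_int
        by (intro nn_integral_eq_integral) (auto intro!: sum_nonneg s_bd s_int)
      then show "(\<integral>\<^sup>+\<zeta>. ennreal (\<Sum>n<N. s n \<zeta>) \<partial>S) \<le> ennreal B"
        using B[of N] by (simp add: ennreal_leI)
    qed
    finally have "(\<integral>\<^sup>+\<zeta>. ennreal (l \<zeta>) \<partial>S) < \<infinity>"
      by (simp add: le_less_trans)
    then have l_int: "integrable S l"
      by (intro integrableI_nonneg) (auto simp: l_def)
    show "integrable S (\<lambda>\<zeta>. ln (1 / x \<zeta>))"
    proof (rule Bochner_Integration.integrable_bound)
      show "integrable S (\<lambda>\<zeta>. k * l \<zeta> + \<bar>ln a\<bar> + \<bar>ln R\<bar>)"
        by (intro Bochner_Integration.integrable_add integrable_mult_right l_int) auto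
      show "AE \<zeta> in S. norm (ln (1 / x \<zeta>)) \<le> norm (k * l \<zeta> + \<bar>ln a\<bar> + \<bar>ln R\<bar>)"
      proof (rule AE_I2)
        fix \<zeta> assume "\<zeta> \<in> space S"
        with x_bd have x: "0 < x \<zeta>" "x \<zeta> \<le> R" by auto
        have "ln (x \<zeta>) \<le> ln R" using x by simp
        moreover have "k * l \<zeta> = max 0 (ln a - ln (x \<zeta>))"
          using k a x by (simp add: l_def ln_div max_def field_simps)
        ultimately have "\<bar>ln (x \<zeta>)\<bar> \<le> k * l \<zeta> + \<bar>ln a\<bar> + \<bar>ln R\<bar>"
          by linarith
        then show "norm (ln (1 / x \<zeta>)) \<le> norm (k * l \<zeta> + \<bar>ln a\<bar> + \<bar>ln R\<bar>)"
          using x by (simp add: ln_div)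
      qed
    qed measurable
  next
    assume int: "integrable S (\<lambda>\<zeta>. ln (1 / x \<zeta>))"
    define h where "h \<zeta> = (\<bar>ln A\<bar> + \<bar>ln (1 / x \<zeta>)\<bar>) / ln (1 / d) + 1 + 1 / (1 - d)" for \<zeta>
    have h_int: "integrable S h"
      unfolding h_def
      by (intro Bochner_Integration.integrable_add integrable_divide integrable_abs int) auto
    have "(\<Sum>n<N. integral\<^sup>L S (s n)) \<le> integral\<^sup>L S h" for N
      unfolding sum_int
    proof (rule integral_mono)
      fix \<zeta> assume "\<zeta> \<in> space S"
      with x_bd have x: "0 < x \<zeta>" by auto
      have "\<bar>ln (A / x \<zeta>)\<bar> \<le> \<bar>ln A\<bar> + \<bar>ln (1 / x \<zeta>)\<bar>"
        using A x by (simp add: ln_div)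
      then have "\<bar>ln (A / x \<zeta>)\<bar> / ln (1 / d) \<le> (\<bar>ln A\<bar> + \<bar>ln (1 / x \<zeta>)\<bar>) / ln (1 / d)"
        using d by (intro divide_right_mono) auto
      moreover have "(\<Sum>n<N. s n \<zeta>) \<le> \<bar>ln (A / x \<zeta>)\<bar> / ln (1 / d) + 1 + 1 / (1 - d)"
        unfolding s_def by (rule geometric_upper_sum[OF A d x q0 q(2)])
      ultimately show "(\<Sum>n<N. s n \<zeta>) \<le> h \<zeta>"
        by (simp add: h_def)
    qed (use s_int h_int in auto)
    then show "\<exists>B. \<forall>N. (\<Sum>n<N. integral\<^sup>L S (s n)) \<le> B" by blast
  qed
qed

section \<open>Growth of the orbit in the half-plane\<close>

text \<open>
  The pseudohyperbolic distance is invariant under the Cayley transform \<open>herglotz_kernel \<tau>\<close>; on the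
  half-plane it is \<open>|A - B| / |A + cnj B|\<close>.
\<close>

lemma herglotz_kernel_pseudodistance:
  assumes \<tau>: "cmod \<tau> = 1" and ab: "a \<in> unit_disc" "b \<in> unit_disc"
  shows "cmod (herglotz_kernel \<tau> a - herglotz_kernel \<tau> b) =
    cmod ((a - b) / (1 - cnj b * a)) * cmod (herglotz_kernel \<tau> a + cnj (herglotz_kernel \<tau> b))"
proof -
  have ne: "\<tau> - a \<noteq> 0" "\<tau> - b \<noteq> 0" using \<tau> ab by auto
  then have ne': "cnj \<tau> - cnj b \<noteq> 0" by (metis complex_cnj_cnj complex_cnj_diff complex_cnj_zero)
  have \<tau>\<tau>: "\<tau> * cnj \<tau> = 1" using \<tau> complex_norm_square[of \<tau>] by simp
  have "herglotz_kernel \<tau> a - herglotz_kernel \<tau> b = 2 * \<tau> * (a - b) / ((\<tau> - a) * (\<tau> - b))"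
    using ne by (simp add: herglotz_kernel_def divide_simps) (simp add: algebra_simps)
  then have 1: "cmod (herglotz_kernel \<tau> a - herglotz_kernel \<tau> b) = 2 * cmod (a - b) / (cmod (\<tau> - a) * cmod (\<tau> - b))"
    using \<tau> by (simp add: norm_mult norm_divide)
  have "herglotz_kernel \<tau> a + cnj (herglotz_kernel \<tau> b)
      = ((\<tau> + a) * (cnj \<tau> - cnj b) + (cnj \<tau> + cnj b) * (\<tau> - a)) / ((\<tau> - a) * cnj (\<tau> - b))"
    using ne ne' by (simp add: herglotz_kernel_def divide_simps)
  also have "(\<tau> + a) * (cnj \<tau> - cnj b) + (cnj \<tau> + cnj b) * (\<tau> - a) = 2 * (\<tau> * cnj \<tau>) - 2 * (cnj b * a)"
    by (simp add: algebra_simps)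
  also have "\<dots> = 2 * (1 - cnj b * a)"
    by (simp add: \<tau>\<tau>)
  finally have 2: "cmod (herglotz_kernel \<tau> a + cnj (herglotz_kernel \<tau> b))
      = 2 * cmod (1 - cnj b * a) / (cmod (\<tau> - a) * cmod (\<tau> - b))"
    by (simp only: norm_mult norm_divide complex_mod_cnj) simp
  show ?thesis
    unfolding 1 2 using moebius_denominator_nonzero[of a b] ab by (simp add: norm_divide)
qed

text \<open>
  With \<open>t\<close> the pseudohyperbolic distance, \<open>2 artanh t = 2 ln (1 + t) - ln (1 - t\<^sup>2)\<close>, and
  \<open>1 - t\<^sup>2\<close> equals \<open>1 - |z|\<^sup>2\<close> up to factors that stay between positive constants depending only on \<open>w\<close>.
\<close>

lemma hyp_dist_asymptotics:
  assumes w: "w \<in> unit_disc"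
  shows "\<exists>E. \<forall>z\<in>unit_disc. \<bar>hyp_dist z w + ln (1 - (cmod z)\<^sup>2)\<bar> \<le> E"
proof (intro exI ballI)
  fix z assume z: "z \<in> unit_disc"
  define t where "t = cmod ((z - w) / (1 - cnj w * z))"
  define d where "d = cmod (1 - cnj w * z)"
  have d0: "d > 0" using moebius_denominator_nonzero[of z w] z w by (simp add: d_def)
  have zw: "0 < 1 - (cmod z)\<^sup>2" "0 < 1 - (cmod w)\<^sup>2" using z w by (simp_all add: power_less_one_iff)
  have "1 - t\<^sup>2 = (d\<^sup>2 - (cmod (z - w))\<^sup>2) / d\<^sup>2"
    using d0 unfolding t_def norm_divide power_divide d_def[symmetric] by (simp add: diff_divide_distrib)
  also have "d\<^sup>2 - (cmod (z - w))\<^sup>2 = (1 - (cmod z)\<^sup>2) * (1 - (cmod w)\<^sup>2)"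
    unfolding d_def by (rule moebius_identity)
  finally have t2: "1 - t\<^sup>2 = (1 - (cmod z)\<^sup>2) * (1 - (cmod w)\<^sup>2) / d\<^sup>2" .
  then have "1 - t\<^sup>2 > 0" using zw d0 by simp
  then have t: "0 \<le> t" "t < 1" by (auto simp: t_def power_less_one_iff)
  have "hyp_dist z w = ln ((1 + t) / (1 - t))"
    by (simp add: hyp_dist_def t_def artanh_def)
  also have "(1 + t) / (1 - t) = ((1 + t) * (1 + t)) / ((1 + t) * (1 - t))"
    using t by simp
  also have "\<dots> = (1 + t)\<^sup>2 / (1 - t\<^sup>2)"
    by (simp add: power2_eq_square algebra_simps)
  also have "ln \<dots> = 2 * ln (1 + t) - (ln (1 - (cmod z)\<^sup>2) + ln (1 - (cmod w)\<^sup>2) - 2 * ln d)"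
    using t \<open>1 - t\<^sup>2 > 0\<close> zw d0 by (simp add: ln_div ln_realpow t2 ln_mult)
  finally have eq: "hyp_dist z w + ln (1 - (cmod z)\<^sup>2) = 2 * ln (1 + t) - ln (1 - (cmod w)\<^sup>2) + 2 * ln d"
    by simp
  have lt: "0 \<le> ln (1 + t)" "ln (1 + t) \<le> ln 2" using t by auto
  have wz: "cmod (cnj w * z) \<le> cmod w"
    using z mult_left_le[of "cmod z" "cmod w"] by (simp add: norm_mult)
  have "d \<le> 2"
    using norm_triangle_ineq4[of 1 "cnj w * z"] wz w by (simp add: d_def)
  moreover have "1 - cmod w \<le> d"
    using norm_triangle_ineq2[of 1 "cnj w * z"] wz by (simp add: d_def)
  ultimately have "ln d \<le> ln 2" "ln (1 - cmod w) \<le> ln d"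
    using d0 w by auto
  with eq lt show "\<bar>hyp_dist z w + ln (1 - (cmod z)\<^sup>2)\<bar>
      \<le> 2 * ln 2 + \<bar>ln (1 - (cmod w)\<^sup>2)\<bar> + 2 * (ln 2 + \<bar>ln (1 - cmod w)\<bar>)"
    by (smt (verit))
qed

text \<open>
  The growth of an orbit is read off from the representation together with Schwarz--Pick. That the orbit
  tends to \<open>\<tau>\<close>, even geometrically fast, is a conclusion here (\<open>q_geometric\<close>).
\<close>

locale herglotz_orbit =
  fixes g :: "complex \<Rightarrow> complex" and \<tau> :: complex and \<alpha> b :: real and \<sigma> :: "complex measure"
    and z0 :: complex
  assumes holo: "g holomorphic_on unit_disc" and self_map: "g ` unit_disc \<subseteq> unit_disc"
    and \<tau>: "cmod \<tau> = 1" and \<alpha>: "0 < \<alpha>" "\<alpha> < 1"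
    and \<sigma>: "finite_borel_measure_on (unit_circle - {\<tau>}) \<sigma>"
    and rep: "herglotz_rep g \<tau> \<alpha> b \<sigma>"
    and z0: "z0 \<in> unit_disc"

begin

definition Z :: "nat \<Rightarrow> complex" where "Z n = (g ^^ n) z0"
definition W :: "nat \<Rightarrow> complex" where "W n = herglotz_kernel \<tau> (Z n)"
definition u :: "nat \<Rightarrow> real" where "u n = Re (W n)"
definition q :: "nat \<Rightarrow> real" where "q n = cmod (\<tau> - Z n)"

text \<open>
  The relative growth of \<open>u\<close> in one step that is due to \<open>\<sigma>\<close>. The integrand is the quotient of the
  Poisson kernels of \<open>Z n\<close> at \<open>\<zeta>\<close> and at \<open>\<tau>\<close>.
\<close>

definition I :: "nat \<Rightarrow> real" where "I n = (\<integral>\<zeta>. (q n / cmod (\<zeta> - Z n))\<^sup>2 \<partial>\<sigma>)"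

lemma Z_Suc: "Z (Suc n) = g (Z n)"
  by (simp add: Z_def)

lemma Z_in_disc: "Z n \<in> unit_disc"
  by (induction n) (use z0 self_map in \<open>auto simp: Z_def image_subset_iff\<close>)

lemma norm_Z: "cmod (Z n) < 1"
  using Z_in_disc[of n] by simp

lemma u_pos: "0 < u n"
  unfolding u_def W_def by (rule Re_herglotz_kernel_pos[OF \<tau> Z_in_disc])

lemma Z_ne: "\<tau> \<noteq> Z n"
  using norm_Z[of n] \<tau> by auto

lemma q_pos: "0 < q n"
  using Z_ne by (simp add: q_def)

lemma boundary_distance: "1 - (cmod (Z n))\<^sup>2 = u n * (q n)\<^sup>2"
  using Re_herglotz_kernel[OF \<tau>, of "Z n"] q_pos[of n] by (simp add: u_def W_def q_def)

lemma finite_\<sigma>: "finite_measure \<sigma>"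
  and sets_\<sigma>: "sets \<sigma> = sets (restrict_space borel (unit_circle - {\<tau>}))"
  using \<sigma> by (auto simp: finite_borel_measure_on_def)

lemma space_\<sigma>: "space \<sigma> = unit_circle - {\<tau>}"
  using sets_eq_imp_space_eq[OF sets_\<sigma>] by (simp add: space_restrict_space)

lemma measurable_\<sigma>: "f \<in> borel_measurable borel \<Longrightarrow> f \<in> borel_measurable \<sigma>"
  using measurable_cong_sets[OF sets_\<sigma> refl] measurable_restrict_space1 by blast

lemma integrable_ratio: "integrable \<sigma> (\<lambda>\<zeta>. (q n / cmod (\<zeta> - Z n))\<^sup>2)"
proof -
  have "integrable \<sigma> (\<lambda>\<zeta>. Re (herglotz_kernel \<zeta> (Z n)) / u n)"
    by (intro integrable_divide integrable_Re integrable_herglotz_kernel[OF finite_\<sigma> sets_\<sigma> _ Z_in_disc]) auto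
  moreover have "Re (herglotz_kernel \<zeta> (Z n)) / u n = (q n / cmod (\<zeta> - Z n))\<^sup>2" if "\<zeta> \<in> space \<sigma>" for \<zeta>
    using that u_pos[of n] by (simp add: space_\<sigma> Re_herglotz_kernel boundary_distance power_divide)
  ultimately show ?thesis
    by (simp cong: Bochner_Integration.integrable_cong)
qed

lemma I_nonneg: "0 \<le> I n"
  unfolding I_def by (intro integral_nonneg_AE) auto

text \<open>
  The real part of the Herglotz representation at \<open>Z n\<close>.
\<close>

lemma u_Suc: "u (Suc n) = u n * (1 / \<alpha> + I n)"
proof -
  have "W (Suc n) = 1 / \<alpha> * W n + \<i> * b + (\<integral>\<zeta>. herglotz_kernel \<zeta> (Z n) \<partial>\<sigma>)"
    using rep Z_in_disc[of n] unfolding herglotz_rep_def herglotz_kernel_cayley[OF \<tau>]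
    by (simp add: W_def Z_Suc herglotz_kernel_def)
  moreover have "Re (\<integral>\<zeta>. herglotz_kernel \<zeta> (Z n) \<partial>\<sigma>) = (\<integral>\<zeta>. Re (herglotz_kernel \<zeta> (Z n)) \<partial>\<sigma>)"
    by (intro integral_Re[symmetric] integrable_herglotz_kernel[OF finite_\<sigma> sets_\<sigma> _ Z_in_disc]) auto
  moreover have "\<dots> = (\<integral>\<zeta>. u n * (q n / cmod (\<zeta> - Z n))\<^sup>2 \<partial>\<sigma>)"
    by (intro Bochner_Integration.integral_cong)
       (auto simp: space_\<sigma> Re_herglotz_kernel boundary_distance power_divide)
  ultimately show ?thesis
    by (simp add: u_def I_def algebra_simps)
qed

lemma u_Suc_ge: "u n \<le> \<alpha> * u (Suc n)"
  using \<alpha> u_pos[of n] I_nonneg[of n] by (simp add: u_Suc distrib_left mult.assoc[symmetric])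

lemma u_lower: "u 0 * (1 / \<alpha>) ^ n \<le> u n"
proof (induction n)
  case (Suc n)
  have "u 0 * (1 / \<alpha>) ^ Suc n = u 0 * (1 / \<alpha>) ^ n / \<alpha>"
    by simp
  also have "\<dots> \<le> u n / \<alpha>"
    using Suc \<alpha> by (intro divide_right_mono) auto
  also have "\<dots> \<le> u (Suc n)"
    using u_Suc_ge[of n] \<alpha> by (simp add: pos_divide_le_eq mult.commute)
  finally show ?case .
qed simp

lemma u_mono: "u 0 \<le> u n"
proof -
  have "u 0 * 1 \<le> u 0 * (1 / \<alpha>) ^ n"
    using \<alpha> u_pos[of 0] by (intro mult_left_mono one_le_power) auto
  also have "\<dots> \<le> u n" by (rule u_lower)
  finally show ?thesis by simp
qed

text \<open>
  By Schwarz--Pick all pseudohyperbolic steps are at most the first one, which is smaller than \<open>1\<close>. In the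
  half-plane such a bound limits the Euclidean step by a multiple of the distance to the boundary.
\<close>

lemma bounded_step: "\<exists>D\<ge>0. \<forall>n. cmod (W (Suc n) - W n) \<le> D * u n"
proof -
  define \<psi> where "\<psi> n = cmod ((Z (Suc n) - Z n) / (1 - cnj (Z n) * Z (Suc n)))" for n
  have "\<psi> 0 < 1"
    using Moebius_function_norm_lt_1[OF norm_Z norm_Z, of 0 0 1] by (simp add: \<psi>_def Moebius_function_simple)
  have \<psi>: "\<psi> n \<le> \<psi> 0" for n
  proof (induction n)
    case (Suc n)
    have "\<psi> (Suc n) \<le> \<psi> n"
      using schwarz_pick[OF holo self_map Z_in_disc[of "Suc n"] Z_in_disc[of n]]
      by (simp add: \<psi>_def Z_Suc)
    with Suc show ?case by simp
  qed simp
  have "cmod (W (Suc n) - W n) \<le> 2 * \<psi> 0 / (1 - \<psi> 0) * u n" for n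
  proof -
    have eq: "W (Suc n) + cnj (W n) = (W (Suc n) - W n) + of_real (2 * u n)"
      by (simp add: u_def complex_eq_iff)
    have "cmod (W (Suc n) + cnj (W n)) \<le> cmod (W (Suc n) - W n) + 2 * u n"
      unfolding eq using norm_triangle_ineq[of "W (Suc n) - W n" "of_real (2 * u n)"] u_pos[of n] by simp
    moreover have "cmod (W (Suc n) - W n) = \<psi> n * cmod (W (Suc n) + cnj (W n))"
      unfolding W_def \<psi>_def by (rule herglotz_kernel_pseudodistance[OF \<tau> Z_in_disc Z_in_disc])
    ultimately have "cmod (W (Suc n) - W n) \<le> \<psi> 0 * (cmod (W (Suc n) - W n) + 2 * u n)"
      using mult_mono[OF \<psi>[of n], of "cmod (W (Suc n) + cnj (W n))" "cmod (W (Suc n) - W n) + 2 * u n"]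
      by (simp add: \<psi>_def)
    then show ?thesis
      using \<open>\<psi> 0 < 1\<close> by (simp add: field_simps)
  qed
  moreover have "0 \<le> 2 * \<psi> 0 / (1 - \<psi> 0)"
    using \<open>\<psi> 0 < 1\<close> by (simp add: \<psi>_def)
  ultimately show ?thesis by blast
qed

text \<open>
  The orbit stays in a sector, because steps of size \<open>O(u n)\<close> are summable against the geometric growth
  of \<open>u n\<close>. In the disc this is non-tangential convergence to \<open>\<tau>\<close>.
\<close>

lemma sector: "\<exists>M>0. \<forall>n. cmod (W n) \<le> M * u n"
proof -
  obtain D where D: "D \<ge> 0" "\<And>n. cmod (W (Suc n) - W n) \<le> D * u n"
    using bounded_step by blast
  (* The first summand starts the induction; the second gives (M + D) \<alpha> \<le> M, which is what one
     step of the orbit needs; the third makes M positive. *)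
  define M where "M = cmod (W 0) / u 0 + D * \<alpha> / (1 - \<alpha>) + 1"
  have M: "(M + D) * \<alpha> \<le> M" "0 < M"
  proof -
    have "D * \<alpha> / (1 - \<alpha>) \<le> M" using u_pos[of 0] by (simp add: M_def)
    then show "(M + D) * \<alpha> \<le> M" using \<alpha> by (simp add: pos_divide_le_eq algebra_simps)
    have "0 \<le> cmod (W 0) / u 0" "0 \<le> D * \<alpha> / (1 - \<alpha>)" using D \<alpha> u_pos[of 0] by auto
    then show "0 < M" by (simp add: M_def)
  qed
  have "cmod (W n) \<le> M * u n" for n
  proof (induction n)
    case 0
    have "cmod (W 0) / u 0 \<le> M" using D \<alpha> by (simp add: M_def)
    then show ?case using u_pos[of 0] by (simp add: pos_divide_le_eq)
  next
    case (Suc n)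
    have "cmod (W (Suc n)) \<le> (M + D) * u n"
      using Suc D(2)[of n] norm_triangle_sub[of "W (Suc n)" "W n"] by (simp add: algebra_simps)
    also have "\<dots> \<le> (M + D) * (\<alpha> * u (Suc n))"
      using M D u_Suc_ge by (intro mult_left_mono) auto
    also have "\<dots> \<le> M * u (Suc n)"
      using mult_right_mono[OF M(1), of "u (Suc n)"] u_pos[of "Suc n"] by (simp add: mult_ac)
    finally show ?case .
  qed
  then show ?thesis using M by blast
qed

lemma u_upper: "\<exists>B>1. \<forall>n. u n \<le> u 0 * B ^ n"
proof -
  obtain D where D: "D \<ge> 0" "\<And>n. cmod (W (Suc n) - W n) \<le> D * u n"
    using bounded_step by blast
  have step: "u (Suc n) \<le> (D + 2) * u n" for n
  proof -
    have "u (Suc n) - u n \<le> cmod (W (Suc n) - W n)"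
      using complex_Re_le_cmod[of "W (Suc n) - W n"] by (simp add: u_def)
    then show ?thesis using D(2)[of n] u_pos[of n] by (simp add: algebra_simps)
  qed
  have "u n \<le> u 0 * (D + 2) ^ n" for n
  proof (induction n)
    case (Suc n)
    have "(D + 2) * u n \<le> (D + 2) * (u 0 * (D + 2) ^ n)"
      using Suc D by (intro mult_left_mono) auto
    with step[of n] show ?case by (simp add: mult_ac)
  qed simp
  (* D + 1 would bound the ratio; D + 2 makes the base strictly larger than 1. *)
  then show ?thesis using D by (intro exI[of _ "D + 2"]) auto
qed

text \<open>
  In the half-plane \<open>q n = 2 / |W n + 1|\<close>, and in a sector \<open>|W n + 1|\<close> is comparable with \<open>u n\<close>.
\<close>

lemma q_u: "\<exists>P>0. \<forall>n. 2 / P \<le> u n * q n \<and> u n * q n \<le> 2"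
proof -
  obtain M where M: "M > 0" "\<And>n. cmod (W n) \<le> M * u n"
    using sector by blast
  have "2 / (1 / u 0 + M) \<le> u n * q n \<and> u n * q n \<le> 2" for n
  proof -
    have "W n + 1 = 2 * \<tau> / (\<tau> - Z n)"
      unfolding W_def by (rule herglotz_kernel_plus_one[OF Z_ne])
    then have W1: "cmod (W n + 1) = 2 / q n"
      using \<tau> by (simp add: norm_divide norm_mult q_def)
    have "u n \<le> cmod (W n + 1)"
      using complex_Re_le_cmod[of "W n + 1"] by (simp add: u_def)
    then have 1: "u n * q n \<le> 2"
      unfolding W1 using q_pos[of n] by (simp add: pos_le_divide_eq)
    have "2 / q n \<le> M * u n + 1"
      unfolding W1[symmetric] using norm_triangle_ineq[of "W n" 1] M(2)[of n] by simp
    also have "1 \<le> (1 / u 0) * u n"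
      using u_mono[of n] u_pos[of 0] by simp
    finally have "2 / q n \<le> (1 / u 0 + M) * u n"
      by (simp add: algebra_simps)
    then have "2 \<le> (1 / u 0 + M) * (u n * q n)"
      using q_pos[of n] by (simp add: pos_divide_le_eq mult.assoc)
    moreover have "0 < 1 / u 0 + M" using u_pos[of 0] M(1) by (simp add: add_pos_pos)
    ultimately show ?thesis
      using 1 by (simp add: pos_divide_le_eq mult.commute)
  qed
  moreover have "0 < 1 / u 0 + M" using u_pos[of 0] M(1) by (simp add: add_pos_pos)
  ultimately show ?thesis by blast
qed

lemma q_geometric:
  "\<exists>a c A. 0 < a \<and> 0 < c \<and> c < 1 \<and> 0 < A \<and> (\<forall>n. a * c ^ n \<le> q n \<and> q n \<le> A * \<alpha> ^ n)"
proof -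
  obtain P where P: "P > 0" "\<And>n. 2 / P \<le> u n * q n" "\<And>n. u n * q n \<le> 2"
    using q_u by blast
  obtain B where B: "B > 1" "\<And>n. u n \<le> u 0 * B ^ n"
    using u_upper by blast
  have u0: "0 < u 0" by (rule u_pos)
  have "(2 / P / u 0) * (1 / B) ^ n \<le> q n" for n
  proof -
    have "2 / P \<le> u n * q n" by (rule P(2))
    also have "\<dots> \<le> (u 0 * B ^ n) * q n"
      using q_pos[of n] by (intro mult_right_mono B) auto
    finally have "2 / P / (u 0 * B ^ n) \<le> q n"
      using u0 B(1) by (subst pos_divide_le_eq) (simp_all add: mult_ac)
    then show ?thesis by (simp add: power_divide)
  qed
  moreover have "q n \<le> (2 / u 0) * \<alpha> ^ n" for n
  proof -
    have "(u 0 * (1 / \<alpha>) ^ n) * q n \<le> u n * q n"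
      using q_pos[of n] by (intro mult_right_mono u_lower) auto
    also have "\<dots> \<le> 2" by (rule P(3))
    finally show ?thesis
      using u0 \<alpha> by (simp add: field_simps)
  qed
  moreover have "0 < 2 / P / u 0" "0 < 1 / B" "1 / B < 1" "0 < 2 / u 0"
    using P(1) B(1) u0 by auto
  ultimately show ?thesis by blast
qed

text \<open>
  Non-tangentially, \<open>|\<zeta> - Z n| \<ge> 1 - |Z n|\<close> dominates \<open>q n\<close>, and therefore also \<open>|\<zeta> - \<tau>| + q n\<close>.
\<close>

lemma poisson_ratio_comparable:
  "\<exists>C>0. \<forall>n. \<forall>\<zeta>\<in>space \<sigma>.
     (q n / (cmod (\<zeta> - \<tau>) + q n))\<^sup>2 \<le> (q n / cmod (\<zeta> - Z n))\<^sup>2 \<and>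
     (q n / cmod (\<zeta> - Z n))\<^sup>2 \<le> C * (q n / (cmod (\<zeta> - \<tau>) + q n))\<^sup>2"
proof -
  obtain P where P: "P > 0" "\<And>n. 2 / P \<le> u n * q n"
    using q_u by blast
  have "(q n / (cmod (\<zeta> - \<tau>) + q n))\<^sup>2 \<le> (q n / cmod (\<zeta> - Z n))\<^sup>2 \<and>
     (q n / cmod (\<zeta> - Z n))\<^sup>2 \<le> (1 + 2 * P)\<^sup>2 * (q n / (cmod (\<zeta> - \<tau>) + q n))\<^sup>2"
    if "\<zeta> \<in> space \<sigma>" for n \<zeta>
  proof -
    have \<zeta>: "cmod \<zeta> = 1" using that by (simp add: space_\<sigma>)
    define x where "x = cmod (\<zeta> - \<tau>)"
    define y where "y = cmod (\<zeta> - Z n)"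
    have y: "0 < y" using \<zeta> norm_Z[of n] by (auto simp: y_def)
    have x: "0 \<le> x" by (simp add: x_def)
    have "y \<le> x + q n"
      using norm_triangle_ineq[of "\<zeta> - \<tau>" "\<tau> - Z n"] by (simp add: x_def y_def q_def)
    have "x \<le> y + q n"
      using norm_triangle_ineq4[of "\<zeta> - Z n" "\<tau> - Z n"] by (simp add: x_def y_def q_def)
    have "2 / P * q n \<le> (u n * q n) * q n"
      using P(2)[of n] q_pos[of n] by (intro mult_right_mono) auto
    also have "\<dots> = (1 - cmod (Z n)) * (1 + cmod (Z n))"
      using boundary_distance[of n] by (simp add: power2_eq_square algebra_simps)
    also have "\<dots> \<le> (1 - cmod (Z n)) * 2"
      using norm_Z[of n] by (intro mult_left_mono) auto
    also have "1 - cmod (Z n) \<le> y"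
      using norm_triangle_ineq2[of \<zeta> "Z n"] \<zeta> by (simp add: y_def)
    finally have "q n \<le> P * y"
      using P(1) by (simp add: field_simps)
    with \<open>x \<le> y + q n\<close> have le: "x + q n \<le> (1 + 2 * P) * y"
      by (simp add: algebra_simps)
    have "q n / (x + q n) \<le> q n / y"
      using \<open>y \<le> x + q n\<close> y q_pos[of n] by (intro divide_left_mono) auto
    moreover have "q n / y \<le> (1 + 2 * P) * (q n / (x + q n))"
    proof -
      have "q n * (x + q n) \<le> q n * ((1 + 2 * P) * y)"
        using le q_pos[of n] by (intro mult_left_mono) auto
      then show ?thesis
        using y x q_pos[of n] by (simp add: divide_simps mult_ac)
    qed
    ultimately show ?thesis
      unfolding x_def[symmetric] y_def[symmetric] power_mult_distrib[symmetric]
      using y x q_pos[of n] by (intro conjI power_mono) auto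
  qed
  then show ?thesis
    using P(1) by (intro exI[of _ "(1 + 2 * P)\<^sup>2"]) auto
qed

section \<open>Summability and the hyperbolic rate\<close>

lemma sum_I_bounded_iff:
  "(\<exists>B. \<forall>N. (\<Sum>n<N. I n) \<le> B) \<longleftrightarrow> integrable \<sigma> (\<lambda>\<zeta>. ln (1 / cmod (\<zeta> - \<tau>)))"
proof -
  obtain a c A where q: "0 < a" "0 < c" "c < 1" "0 < A" "\<And>n. a * c ^ n \<le> q n" "\<And>n. q n \<le> A * \<alpha> ^ n"
    using q_geometric by blast
  obtain C where C: "C > 0"
    "\<And>n \<zeta>. \<zeta> \<in> space \<sigma> \<Longrightarrow> (q n / (cmod (\<zeta> - \<tau>) + q n))\<^sup>2 \<le> (q n / cmod (\<zeta> - Z n))\<^sup>2"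
    "\<And>n \<zeta>. \<zeta> \<in> space \<sigma> \<Longrightarrow> (q n / cmod (\<zeta> - Z n))\<^sup>2 \<le> C * (q n / (cmod (\<zeta> - \<tau>) + q n))\<^sup>2"
    using poisson_ratio_comparable by blast
  define J where "J n = (\<integral>\<zeta>. (q n / (cmod (\<zeta> - \<tau>) + q n))\<^sup>2 \<partial>\<sigma>)" for n
  have meas: "(\<lambda>\<zeta>. cmod (\<zeta> - \<tau>)) \<in> borel_measurable \<sigma>"
    by (rule measurable_\<sigma>) measurable
  have J_int: "integrable \<sigma> (\<lambda>\<zeta>. (q n / (cmod (\<zeta> - \<tau>) + q n))\<^sup>2)" for n
    by (rule Bochner_Integration.integrable_bound[OF integrable_ratio[of n]])
       (use C(2) in \<open>auto intro!: measurable_\<sigma> AE_I2\<close>)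
  have JI: "J n \<le> I n" for n
    unfolding J_def I_def by (intro integral_mono J_int integrable_ratio C)
  have IJ: "I n \<le> C * J n" for n
  proof -
    have "I n \<le> (\<integral>\<zeta>. C * (q n / (cmod (\<zeta> - \<tau>) + q n))\<^sup>2 \<partial>\<sigma>)"
      unfolding I_def by (intro integral_mono integrable_mult_right J_int integrable_ratio C)
    then show ?thesis by (simp add: J_def)
  qed
  have "(\<exists>B. \<forall>N. (\<Sum>n<N. I n) \<le> B) \<longleftrightarrow> (\<exists>B. \<forall>N. (\<Sum>n<N. J n) \<le> B)"
  proof
    assume "\<exists>B. \<forall>N. (\<Sum>n<N. I n) \<le> B"
    then obtain B where B: "\<And>N. (\<Sum>n<N. I n) \<le> B" by blast
    have "(\<Sum>n<N. J n) \<le> B" for N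
      by (rule order_trans[OF sum_mono[OF JI] B])
    then show "\<exists>B. \<forall>N. (\<Sum>n<N. J n) \<le> B" by blast
  next
    assume "\<exists>B. \<forall>N. (\<Sum>n<N. J n) \<le> B"
    then obtain B where B: "\<And>N. (\<Sum>n<N. J n) \<le> B" by blast
    have "(\<Sum>n<N. I n) \<le> C * B" for N
    proof -
      have "(\<Sum>n<N. I n) \<le> C * (\<Sum>n<N. J n)"
        unfolding sum_distrib_left by (rule sum_mono[OF IJ])
      also have "\<dots> \<le> C * B"
        using B C(1) by (intro mult_left_mono) auto
      finally show ?thesis .
    qed
    then show "\<exists>B. \<forall>N. (\<Sum>n<N. I n) \<le> B" by blast
  qed
  also have "\<dots> \<longleftrightarrow> integrable \<sigma> (\<lambda>\<zeta>. ln (1 / cmod (\<zeta> - \<tau>)))"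
    unfolding J_def
  proof (rule sum_integrals_bounded_iff_log_integrable[OF finite_\<sigma> meas _ q(1-4) \<alpha> q(5,6)])
    fix \<zeta> assume "\<zeta> \<in> space \<sigma>"
    then show "0 < cmod (\<zeta> - \<tau>) \<and> cmod (\<zeta> - \<tau>) \<le> 2"
      using norm_triangle_ineq4[of \<zeta> \<tau>] \<tau> by (auto simp: space_\<sigma>)
  qed
  finally show ?thesis .
qed

text \<open>
  The recursion for \<open>u\<close> gives \<open>\<alpha>\<^sup>n u n = u 0 * (\<Prod>k<n. 1 + \<alpha> I k)\<close>; these are the standard bounds
  \<open>1 + \<Sum>x\<^sub>k \<le> \<Prod>(1 + x\<^sub>k) \<le> exp (\<Sum>x\<^sub>k)\<close> for non-negative \<open>x\<^sub>k\<close>.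
\<close>

lemma normalized_growth:
  "u 0 * (1 + \<alpha> * (\<Sum>k<n. I k)) \<le> \<alpha> ^ n * u n" "\<alpha> ^ n * u n \<le> u 0 * exp (\<alpha> * (\<Sum>k<n. I k))"
proof -
  have step: "\<alpha> ^ Suc n * u (Suc n) = (\<alpha> ^ n * u n) * (1 + \<alpha> * I n)" for n
    using \<alpha> by (simp add: u_Suc algebra_simps)
  show "u 0 * (1 + \<alpha> * (\<Sum>k<n. I k)) \<le> \<alpha> ^ n * u n"
  proof (induction n)
    case (Suc n)
    define S where "S = (\<Sum>k<n. I k)"
    have S: "0 \<le> S" unfolding S_def by (intro sum_nonneg I_nonneg)
    have "0 \<le> u 0 * ((\<alpha> * S) * (\<alpha> * I n))"
      using S I_nonneg[of n] \<alpha> u_pos[of 0] by simp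
    then have "u 0 * (1 + \<alpha> * (S + I n)) \<le> (u 0 * (1 + \<alpha> * S)) * (1 + \<alpha> * I n)"
      by (simp add: algebra_simps)
    also have "\<dots> \<le> (\<alpha> ^ n * u n) * (1 + \<alpha> * I n)"
      using Suc \<alpha> I_nonneg[of n] by (intro mult_right_mono) (auto simp: S_def)
    finally show ?case by (simp only: step S_def sum.lessThan_Suc)
  qed simp
  show "\<alpha> ^ n * u n \<le> u 0 * exp (\<alpha> * (\<Sum>k<n. I k))"
  proof (induction n)
    case (Suc n)
    have "(\<alpha> ^ n * u n) * (1 + \<alpha> * I n) \<le> (u 0 * exp (\<alpha> * (\<Sum>k<n. I k))) * exp (\<alpha> * I n)"
      using \<alpha> I_nonneg[of n] u_pos[of 0] by (intro mult_mono[OF Suc exp_ge_add_one_self]) auto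
    then show ?case
      unfolding step by (simp add: algebra_simps exp_add)
  qed simp
qed

text \<open>
  Since \<open>1 - |Z n|\<^sup>2 = u n (q n)\<^sup>2\<close> and \<open>u n * q n\<close> stays between positive constants, \<open>- ln (1 - |Z n|\<^sup>2)\<close> is
  \<open>ln (u n)\<close> up to a bounded error.
\<close>

lemma rate_vs_growth:
  assumes w: "w \<in> unit_disc"
  shows "\<exists>E. \<forall>n. \<bar>(hyp_dist (Z n) w - real n * ln (1 / \<alpha>)) - ln (\<alpha> ^ n * u n)\<bar> \<le> E"
proof -
  obtain E where E: "\<And>z. z \<in> unit_disc \<Longrightarrow> \<bar>hyp_dist z w + ln (1 - (cmod z)\<^sup>2)\<bar> \<le> E"
    using hyp_dist_asymptotics[OF w] by blast
  obtain P where P: "P > 0" "\<And>n. 2 / P \<le> u n * q n" "\<And>n. u n * q n \<le> 2"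
    using q_u by blast
  have "\<bar>(hyp_dist (Z n) w - real n * ln (1 / \<alpha>)) - ln (\<alpha> ^ n * u n)\<bar> \<le> E + 2 * (\<bar>ln (2 / P)\<bar> + \<bar>ln 2\<bar>)" for n
  proof -
    have uq: "0 < u n * q n" using u_pos q_pos by simp
    have "ln (2 / P) \<le> ln (u n * q n)" "ln (u n * q n) \<le> ln 2"
      using P uq by (simp_all del: ln_le_cancel_iff add: ln_mono)
    moreover have "ln (1 - (cmod (Z n))\<^sup>2) = 2 * ln (u n * q n) - ln (u n)"
      unfolding boundary_distance using u_pos[of n] q_pos[of n] by (simp add: ln_mult ln_realpow)
    moreover have "ln (\<alpha> ^ n * u n) = ln (u n) - real n * ln (1 / \<alpha>)"
      using \<alpha> u_pos[of n] by (simp add: ln_mult ln_realpow ln_div)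
    ultimately show ?thesis
      using E[OF Z_in_disc[of n]] by (smt (verit))
  qed
  then show ?thesis by blast
qed

theorem bounded_rate_iff:
  assumes w: "w \<in> unit_disc"
  shows "bounded (range (\<lambda>n. hyp_dist ((g ^^ n) z0) w - real n * ln (1 / \<alpha>))) \<longleftrightarrow>
         integrable \<sigma> (\<lambda>\<zeta>. ln (1 / cmod (\<zeta> - \<tau>)))"
proof -
  obtain E where E: "\<And>n. \<bar>(hyp_dist (Z n) w - real n * ln (1 / \<alpha>)) - ln (\<alpha> ^ n * u n)\<bar> \<le> E"
    using rate_vs_growth[OF w] by blast
  have u0: "0 < u 0" by (rule u_pos)
  have au: "0 < \<alpha> ^ n * u n" for n using \<alpha> u_pos by simp
  have "bounded (range (\<lambda>n. hyp_dist (Z n) w - real n * ln (1 / \<alpha>))) \<longleftrightarrow> (\<exists>B. \<forall>N. (\<Sum>n<N. I n) \<le> B)"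
  proof
    assume "bounded (range (\<lambda>n. hyp_dist (Z n) w - real n * ln (1 / \<alpha>)))"
    then obtain B where B: "\<And>n. \<bar>hyp_dist (Z n) w - real n * ln (1 / \<alpha>)\<bar> \<le> B"
      by (auto simp: bounded_iff)
    have "(\<Sum>k<n. I k) \<le> exp (B + E) / u 0 / \<alpha>" for n
    proof -
      have "ln (\<alpha> ^ n * u n) \<le> B + E" using B[of n] E[of n] by linarith
      then have "\<alpha> ^ n * u n \<le> exp (B + E)" using au[of n] by (metis exp_le_cancel_iff exp_ln)
      then have "u 0 * (1 + \<alpha> * (\<Sum>k<n. I k)) \<le> exp (B + E)"
        using normalized_growth(1)[of n] by linarith
      moreover have "u 0 * (\<alpha> * (\<Sum>k<n. I k)) \<le> u 0 * (1 + \<alpha> * (\<Sum>k<n. I k))"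
        using u0 by simp
      ultimately have "u 0 * (\<alpha> * (\<Sum>k<n. I k)) \<le> exp (B + E)" by linarith
      then show ?thesis using u0 \<alpha> by (simp add: pos_le_divide_eq mult_ac)
    qed
    then show "\<exists>B. \<forall>N. (\<Sum>n<N. I n) \<le> B" by blast
  next
    assume "\<exists>B. \<forall>N. (\<Sum>n<N. I n) \<le> B"
    then obtain B where B: "\<And>N. (\<Sum>n<N. I n) \<le> B" by blast
    have "\<bar>hyp_dist (Z n) w - real n * ln (1 / \<alpha>)\<bar> \<le> E + \<bar>ln (u 0)\<bar> + \<alpha> * B" for n
    proof -
      let ?S = "\<Sum>k<n. I k"
      have S: "0 \<le> \<alpha> * ?S" using \<alpha> by (simp add: sum_nonneg I_nonneg)
      have SB: "\<alpha> * ?S \<le> \<alpha> * B" using \<alpha> B by (intro mult_left_mono) auto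
      have "u 0 * 1 \<le> u 0 * (1 + \<alpha> * ?S)" using u0 S by (intro mult_left_mono) auto
      then have "u 0 \<le> \<alpha> ^ n * u n" using normalized_growth(1)[of n] by simp
      then have "ln (u 0) \<le> ln (\<alpha> ^ n * u n)" by (intro ln_mono u0)
      moreover have "ln (\<alpha> ^ n * u n) \<le> ln (u 0 * exp (\<alpha> * ?S))"
        using au[of n] normalized_growth(2)[of n] by (intro ln_mono) auto
      moreover have "ln (u 0 * exp (\<alpha> * ?S)) = ln (u 0) + \<alpha> * ?S"
        using u0 by (simp add: ln_mult)
      ultimately show ?thesis using E[of n] S SB by linarith
    qed
    then show "bounded (range (\<lambda>n. hyp_dist (Z n) w - real n * ln (1 / \<alpha>)))"
      by (auto simp: bounded_iff)
  qed
  then show ?thesis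
    unfolding sum_I_bounded_iff by (simp add: Z_def)
qed

end

theorem theorem3p4:
  fixes g :: "complex \<Rightarrow> complex" and \<tau> :: complex and \<alpha> :: real
  assumes "hyperbolic_self_map g \<tau> \<alpha>"
  shows "(\<exists>(b::real) \<sigma>. finite_borel_measure_on (unit_circle - {\<tau>}) \<sigma> \<and> herglotz_rep g \<tau> \<alpha> b \<sigma>) \<and>
         (\<forall>(b::real) \<sigma>. finite_borel_measure_on (unit_circle - {\<tau>}) \<sigma> \<and> herglotz_rep g \<tau> \<alpha> b \<sigma> \<longrightarrow>
            (extremal_hyperbolic_rate g \<alpha> \<longleftrightarrow>
             integrable \<sigma> (\<lambda>\<zeta>. ln (1 / cmod (\<zeta> - \<tau>)))))"
proof (intro conjI allI impI)
  show "\<exists>b \<sigma>. finite_borel_measure_on (unit_circle - {\<tau>}) \<sigma> \<and> herglotz_rep g \<tau> \<alpha> b \<sigma>"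
    by (rule hyperbolic_herglotz_rep_exists[OF assms])
next
  fix b \<sigma>
  assume rep: "finite_borel_measure_on (unit_circle - {\<tau>}) \<sigma> \<and> herglotz_rep g \<tau> \<alpha> b \<sigma>"
  define P where "P z w \<longleftrightarrow> bounded (range (\<lambda>n. hyp_dist ((g ^^ n) z) w - real n * ln (1 / \<alpha>)))"
    for z w
  have "P z w \<longleftrightarrow> integrable \<sigma> (\<lambda>\<zeta>. ln (1 / cmod (\<zeta> - \<tau>)))"
    if "z \<in> unit_disc" "w \<in> unit_disc" for z w
    unfolding P_def
  proof (rule herglotz_orbit.bounded_rate_iff)
    show "herglotz_orbit g \<tau> \<alpha> b \<sigma> z"
      using assms rep that
      by unfold_locales (auto simp: hyperbolic_self_map_def denjoy_wolff_point_def)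
  qed (fact that)
  moreover have "0 \<in> unit_disc" by simp
  ultimately show "extremal_hyperbolic_rate g \<alpha> \<longleftrightarrow> integrable \<sigma> (\<lambda>\<zeta>. ln (1 / cmod (\<zeta> - \<tau>)))"
    unfolding extremal_hyperbolic_rate_def P_def[symmetric] by blast
qed

end
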